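(* Let $q,d\in\mathbb{R}$ with $0<q<d\leq 2q$, and let $W^{[q,d]}=(W^{[q,d]}_t)_{t\in[q,d]}$ be a $(q,d)$-Slepian process. Let $n\in\mathbb{N}=\{1,2,3,\dots\}$, let $n+1$ fixed points in time $t_0,\dots,t_n$ with $q=t_0<t_1<t_2<\ldots<t_n=d$ be given, and let $$c:=\frac{q^{(n+1)/2}}{2^{n}\pi^{(n+1)/2}\sqrt{(3q-d)(d-q)}}.$$ Then for every measurable function $g:[q,d]\to\mathbb{R}$, \begin{align*} & \mathbb{P}\left( W_t^{[q,d]} > g(t) \ \text{for some } t\in[q,d] \right) = 1 - c\cdot\left(\prod_{i=1}^{n-1}\frac{\sqrt{t_{i+1}-q}}{\sqrt{(t_{i+1}-t_{i})(t_i-q)}}\right)\\ &\times\int_{-\infty}^{g(t_0)} \int_{-\infty}^{g(t_n)} \int_{-\infty}^{g(t_{n-1})} \cdots \int_{-\infty}^{g(t_1)} \exp\left[-\frac{q}{4}\left(\frac{(x_0+x_n)^2}{3q-d}+\frac{(x_0-x_n)^2}{d-q}\right) \right]\\ &\times\mathbb{P}\left( W^{[q,d]}_t \leq g(t) \ \forall t\in(t_{0},t_{1}) \,\middle|\, W^{[q,d]}_{t_{0}}=x_{0},\, W^{[q,d]}_{t_{1}}=x_{1}\right)\\ &\times \prod_{i=1}^{n-1} \left\{\mathbb{P}\left( W^{[q,d]}_t \leq g(t) \ \forall t\in(t_{i},t_{i+1}) \,\middle|\, W^{[q,d]}_{t_{i}}=x_{i},\, W^{[q,d]}_{t_{i+1}}=x_{i+1}\right)\right.\\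 &\qquad\left.\times \exp\left[-\frac{q}{4}\left( \frac{ (x_{i}-x_{0})^2}{t_{i}-q}+\frac{ (x_{i+1}-x_{i})^2}{t_{i+1}-t_{i}}-\frac{(x_{i+1}-x_0)^2}{t_{i+1}-q} \right)\right]\right\} \,\mathrm{d} x_1 \cdots \mathrm{d} x_{n-1}\, \mathrm{d} x_n\, \mathrm{d} x_0 . \end{align*}
   Context: For $0<q<d$, a $(q,d)$-Slepian process is a centered, stationary Gaussian process $W^{[q,d]}=(W^{[q,d]}_t)_{t\in[q,d]}$ with continuous sample paths and covariance function $$C(s,s+t)=\left(1-\frac{t}{q}\right)^+,\qquad q\leq s\leq s+t\leq d,$$ where $a^+=a$ if $a\geq 0$ and $a^+=0$ if $a<0$. Equivalently, in law, it is the process $\frac{1}{\sqrt{q}}(B_t-B_{t-q})_{t\in[q,d]}$ with $B$ standard Brownian motion. Conditional probabilities given $W^{[q,d]}_{s}=x,\,W^{[q,d]}_{t}=y$ are taken with respect to the (Gaussian) conditional law of the process given these values. Empty products are equal to $1$; for $n=1$ the integration is only over $x_1$ (upper limit $g(t_1)$) and $x_0$ (upper limit $g(t_0)$). *)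

theory Defs
  imports "HOL-Probability.Probability"
begin

text \<open>Point masses count as (degenerate) Gaussians, as is needed for linear combinations.\<close>

definition gaussian_rv :: "'a measure \<Rightarrow> ('a \<Rightarrow> real) \<Rightarrow> bool" where
  "gaussian_rv M X \<longleftrightarrow>
     X \<in> borel_measurable M \<and>
     ((\<exists>\<mu> \<sigma>. \<sigma> > 0 \<and> distributed M lborel X (normal_density \<mu> \<sigma>)) \<or>
      (\<exists>\<mu>. AE \<omega> in M. X \<omega> = \<mu>))"

definition gaussian_process :: "'a measure \<Rightarrow> real set \<Rightarrow> (real \<Rightarrow> 'a \<Rightarrow> real) \<Rightarrow> bool" where
  "gaussian_process M T X \<longleftrightarrow>
     prob_space M \<and>
     (\<forall>t\<in>T. X t \<in> borel_measurable M) \<and>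
     (\<forall>J a. finite J \<and> J \<subseteq> T \<longrightarrow> gaussian_rv M (\<lambda>\<omega>. \<Sum>t\<in>J. a t * X t \<omega>))"

definition stationary_process :: "'a measure \<Rightarrow> real set \<Rightarrow> (real \<Rightarrow> 'a \<Rightarrow> real) \<Rightarrow> bool" where
  "stationary_process M T X \<longleftrightarrow>
     (\<forall>J h. finite J \<and> J \<subseteq> T \<and> (\<lambda>t. t + h) ` J \<subseteq> T \<longrightarrow>
        distr M (\<Pi>\<^sub>M t\<in>J. borel) (\<lambda>\<omega>. \<lambda>t\<in>J. X (t + h) \<omega>) =
        distr M (\<Pi>\<^sub>M t\<in>J. borel) (\<lambda>\<omega>. \<lambda>t\<in>J. X t \<omega>))"

definition covariance :: "'a measure \<Rightarrow> ('a \<Rightarrow> real) \<Rightarrow> ('a \<Rightarrow> real) \<Rightarrow> real" where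
  "covariance M X Y =
     (LINT \<omega>|M. (X \<omega> - (LINT \<omega>'|M. X \<omega>')) * (Y \<omega> - (LINT \<omega>'|M. Y \<omega>')))"

definition slepian_process ::
    "real \<Rightarrow> real \<Rightarrow> 'a measure \<Rightarrow> (real \<Rightarrow> 'a \<Rightarrow> real) \<Rightarrow> bool" where
  "slepian_process q d M W \<longleftrightarrow>
     0 < q \<and> q < d \<and>
     gaussian_process M {q..d} W \<and>
     stationary_process M {q..d} W \<and>
     (\<forall>t\<in>{q..d}. (LINT \<omega>|M. W t \<omega>) = 0) \<and>
     (\<forall>s t. q \<le> s \<and> s \<le> s + t \<and> s + t \<le> d \<longrightarrow>
        covariance M (W s) (W (s + t)) = max 0 (1 - t / q)) \<and>
     (\<forall>\<omega>\<in>space M. continuous_on {q..d} (\<lambda>t. W t \<omega>))"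

text \<open>
  The space of continuous paths on \<open>[q,d]\<close> with the \<open>\<sigma>\<close>-algebra generated by the evaluations.
  Restricting to continuous paths matters: on it the uncountable intersection
  \<open>{f. \<forall>t\<in>I. f t \<le> g t}\<close> is measurable, whereas in the full product space it need not be.
\<close>

definition path_space :: "real \<Rightarrow> real \<Rightarrow> (real \<Rightarrow> real) measure" where
  "path_space q d = restrict_space (\<Pi>\<^sub>M t\<in>{q..d}. borel) {f. continuous_on {q..d} f}"

definition path_of :: "real \<Rightarrow> real \<Rightarrow> (real \<Rightarrow> 'a \<Rightarrow> real) \<Rightarrow> 'a \<Rightarrow> (real \<Rightarrow> real)" where
  "path_of q d W \<omega> = (\<lambda>t\<in>{q..d}. W t \<omega>)"

text \<open>
  \<open>K (x, y)\<close> is the conditional law of the whole path given \<open>W s = x\<close> and \<open>W u = y\<close>: \<open>K\<close> is a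
  regular conditional distribution all of whose members are Gaussian laws.
  Such a \<open>K\<close> is determined up to a null set of pairs \<open>(x, y)\<close>.
\<close>

definition gaussian_conditional_law ::
    "real \<Rightarrow> real \<Rightarrow> 'a measure \<Rightarrow> (real \<Rightarrow> 'a \<Rightarrow> real) \<Rightarrow> real \<Rightarrow> real \<Rightarrow>
     (real \<times> real \<Rightarrow> (real \<Rightarrow> real) measure) \<Rightarrow> bool" where
  "gaussian_conditional_law q d M W s u K \<longleftrightarrow>
     K \<in> borel \<rightarrow>\<^sub>M prob_algebra (path_space q d) \<and>
     (\<forall>p. gaussian_process (K p) {q..d} (\<lambda>t f. f t)) \<and>
     (\<forall>A\<in>sets (path_space q d).
        AE \<omega> in M. measure (K (W s \<omega>, W u \<omega>)) A =
          real_cond_exp M (vimage_algebra (space M) (\<lambda>\<omega>. (W s \<omega>, W u \<omega>)) borel)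
            (indicator {\<omega> \<in> space M. path_of q d W \<omega> \<in> A}) \<omega>)"

text \<open>
  \<open>iterated_integral b [j\<^sub>1, \<dots>, j\<^sub>m] F x\<close> is
  \<open>\<integral>\<^sub>-\<^sub>\<infinity>\<^sup>b\<^sup>(\<^sup>j\<^sub>1\<^sup>) \<dots> \<integral>\<^sub>-\<^sub>\<infinity>\<^sup>b\<^sup>(\<^sup>j\<^sub>m\<^sup>) F x dx\<^sub>j\<^sub>m \<dots> dx\<^sub>j\<^sub>1\<close>; the head of the list is the
  outermost variable, and coordinates of \<open>x\<close> not in the list are parameters.
\<close>

primrec iterated_integral ::
    "(nat \<Rightarrow> real) \<Rightarrow> nat list \<Rightarrow> ((nat \<Rightarrow> real) \<Rightarrow> real) \<Rightarrow> (nat \<Rightarrow> real) \<Rightarrow> real" where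
  "iterated_integral b [] F x = F x"
| "iterated_integral b (j # js) F x =
     (LINT y:{..b j}|lborel. iterated_integral b js F (x(j := y)))"

end

theory Submission
  imports Defs
begin

text \<open>
  Since \<open>d \<le> 2 q\<close>, two times in \<open>[q, d]\<close> differ by at most \<open>q\<close>, so the covariance is
  \<open>1 - \<bar>s - r\<bar> / q\<close>: for fixed \<open>r\<close> it is affine in \<open>s\<close> on every interval \<open>[a, b]\<close> whose interior
  misses \<open>r\<close>. Hence the error of interpolating \<open>W s\<close> linearly between \<open>W a\<close> and \<open>W b\<close> is
  uncorrelated with every \<open>W r\<close>, \<open>r\<close> outside \<open>(a, b)\<close> (\<open>bridge_orthogonal\<close>). For Gaussian families
  uncorrelated means independent, and two consequences give the theorem.

  First, although \<open>W\<close> is not a Markov process, it has the two-sided Markov property: given \<open>W a\<close> and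
  \<open>W b\<close>, what happens inside \<open>(a, b)\<close> is independent of what happens outside (\<open>markov_block\<close>).
  Applied to the grid intervals in turn, this replaces each event ``below \<open>g\<close> on
  \<open>(t i, t (i + 1))\<close>'' by its conditional probability given the two end values, so that the
  probability of staying below \<open>g\<close> is the expectation of a function of \<open>W (t 0), \<dots>, W (t n)\<close> alone
  (\<open>prob_stays_below\<close>).

  Second, reveal the grid values in the order \<open>t 0, t n, t (n - 1), \<dots>, t 1\<close>, which is the order of
  the iterated integral from the outside in. Taking \<open>a = q\<close> and \<open>b = t (k + 1)\<close> above, the law of
  \<open>W (t k)\<close> given the values already revealed is normal, with mean interpolated between \<open>W q\<close> and
  \<open>W (t (k + 1))\<close>. The joint law is thus built from one-dimensional normal densities by
  repeated use of Fubini's theorem (\<open>sequential_density\<close>), and completing squares turns these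
  densities into the factors of the stated integrand (\<open>normal_density_pair\<close>,
  \<open>normal_density_bridge\<close>, \<open>density_product\<close>).

  Passing from uncorrelated to independent for whole families of variables needs the uniqueness of
  Fourier transforms in several variables. It is obtained from the one-dimensional uniqueness theorem,
  used for one coordinate at a time with a bounded complex weight
  (\<open>fourier_zero_imp_orthogonal\<close>).
\<close>

section \<open>Random variables whose weighted Fourier transform vanishes\<close>

lemma (in prob_space) integrable_bounded:
  fixes Y :: "'a \<Rightarrow> 'b :: {banach, second_countable_topology}"
  assumes "Y \<in> borel_measurable M" "\<And>\<omega>. \<omega> \<in> space M \<Longrightarrow> norm (Y \<omega>) \<le> C"
  shows "integrable M Y"
  using assms by (intro integrable_const_bound[of _ C]) auto

lemma Re_Im_integral_mult_of_real:
  fixes Y :: "'a \<Rightarrow> complex"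
  assumes "integrable M (\<lambda>\<omega>. Y \<omega> * of_real (R \<omega>))"
  shows "Re (\<integral>\<omega>. Y \<omega> * of_real (R \<omega>) \<partial>M) = (\<integral>\<omega>. Re (Y \<omega>) * R \<omega> \<partial>M)"
    and "Im (\<integral>\<omega>. Y \<omega> * of_real (R \<omega>) \<partial>M) = (\<integral>\<omega>. Im (Y \<omega>) * R \<omega> \<partial>M)"
  using integral_Re[OF assms] integral_Im[OF assms] by simp_all

text \<open>
  Tilting \<open>M\<close> by the density \<open>1 + Y / B\<close>, with \<open>B\<close> so large that it is positive, does not change the
  characteristic function of \<open>X\<close>, hence does not change its law.
\<close>
lemma (in prob_space) fourier_zero_imp_indicator_zero_real:
  fixes Y X :: "'a \<Rightarrow> real"
  assumes [measurable]: "Y \<in> borel_measurable M" "X \<in> borel_measurable M"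
    and bd: "\<And>\<omega>. \<omega> \<in> space M \<Longrightarrow> \<bar>Y \<omega>\<bar> \<le> C"
    and zero: "\<And>u. (\<integral>\<omega>. complex_of_real (Y \<omega>) * cis (u * X \<omega>) \<partial>M) = 0"
    and A [measurable]: "A \<in> sets borel"
  shows "(\<integral>\<omega>. Y \<omega> * indicator A (X \<omega>) \<partial>M) = 0"
proof -
  obtain \<omega>0 where "\<omega>0 \<in> space M" using not_empty by auto
  define B where "B = C + 1"
  have B: "B > 0" using bd[OF \<open>\<omega>0 \<in> space M\<close>] by (auto simp: B_def)
  define w where "w \<omega> = 1 + Y \<omega> / B" for \<omega>
  have [measurable]: "w \<in> borel_measurable M" by (simp add: w_def[abs_def])
  have w0: "w \<omega> \<ge> 0" if "\<omega> \<in> space M" for \<omega>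
    using bd[OF that] B by (auto simp: w_def B_def field_simps)
  have intY: "integrable M Y" by (rule integrable_bounded[of _ C]) (use bd in auto)
  have EY: "(\<integral>\<omega>. Y \<omega> \<partial>M) = 0"
    using zero[of 0] by simp
  have intw: "integrable M w" unfolding w_def[abs_def] using intY by auto
  have Ew: "(\<integral>\<omega>. w \<omega> \<partial>M) = 1"
    unfolding w_def[abs_def] using intY EY by (simp add: prob_space)
  define D where "D = density M (\<lambda>\<omega>. ennreal (w \<omega>))"
  have [measurable_cong]: "sets D = sets M" by (simp add: D_def)
  have PD: "prob_space D"
  proof
    have "emeasure D (space D) = (\<integral>\<^sup>+\<omega>. ennreal (w \<omega>) \<partial>M)"
      by (simp add: D_def emeasure_density cong: nn_integral_cong)
    also have "\<dots> = ennreal (\<integral>\<omega>. w \<omega> \<partial>M)"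
      using intw w0 by (intro nn_integral_eq_integral) auto
    finally show "emeasure D (space D) = 1" by (simp add: Ew)
  qed
  interpret D: prob_space D by fact
  have [measurable]: "X \<in> borel_measurable D" by (simp add: D_def)
  have "distr D borel X = distr M borel X"
  proof (rule Levy_uniqueness)
    show "real_distribution (distr D borel X)" "real_distribution (distr M borel X)"
      by (auto intro!: D.real_distribution_distr real_distribution_distr)
    show "char (distr D borel X) = char (distr M borel X)"
    proof
      fix u
      have i1: "integrable M (\<lambda>\<omega>. cis (u * X \<omega>))"
        by (rule integrable_bounded[of _ 1]) (auto simp: cis_conv_exp)
      have i2: "integrable M (\<lambda>\<omega>. complex_of_real (Y \<omega>) * cis (u * X \<omega>))"
        by (rule integrable_bounded[of _ C]) (use bd in \<open>auto simp: norm_mult cis_conv_exp\<close>)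
      have "char (distr D borel X) u = (\<integral>\<omega>. cis (u * X \<omega>) \<partial>D)"
        by (simp add: char_def integral_distr cis_conv_exp)
      also have "\<dots> = (\<integral>\<omega>. w \<omega> *\<^sub>R cis (u * X \<omega>) \<partial>M)"
        unfolding D_def by (rule integral_density) (use w0 in \<open>auto simp: cis_conv_exp\<close>)
      also have "\<dots> = (\<integral>\<omega>. cis (u * X \<omega>) + (1 / B) *\<^sub>R (complex_of_real (Y \<omega>) * cis (u * X \<omega>)) \<partial>M)"
        by (intro Bochner_Integration.integral_cong) (auto simp: w_def scaleR_conv_of_real algebra_simps)
      also have "\<dots> = (\<integral>\<omega>. cis (u * X \<omega>) \<partial>M)"
        using i1 i2 zero[of u] by (subst Bochner_Integration.integral_add) auto
      also have "\<dots> = char (distr M borel X) u"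
        by (simp add: char_def integral_distr cis_conv_exp)
      finally show "char (distr D borel X) u = char (distr M borel X) u" .
    qed
  qed
  then have "(\<integral>x. indicat_real A x \<partial>distr D borel X) = (\<integral>x. indicat_real A x \<partial>distr M borel X)"
    by simp
  then have "(\<integral>\<omega>. indicat_real A (X \<omega>) \<partial>D) = (\<integral>\<omega>. indicat_real A (X \<omega>) \<partial>M)"
    using integral_distr[of X D borel "indicat_real A"] integral_distr[of X M borel "indicat_real A"]
    by (simp del: integral_indicator)
  also have "(\<integral>\<omega>. indicat_real A (X \<omega>) \<partial>D) = (\<integral>\<omega>. w \<omega> *\<^sub>R (indicator A (X \<omega>) :: real) \<partial>M)"
    unfolding D_def by (rule integral_density) (use w0 in auto)
  also have "\<dots> = (\<integral>\<omega>. indicator A (X \<omega>) + (1 / B) * (Y \<omega> * indicator A (X \<omega>)) \<partial>M)"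
    by (intro Bochner_Integration.integral_cong) (auto simp: w_def algebra_simps)
  also have "\<dots> = (\<integral>\<omega>. indicator A (X \<omega>) \<partial>M) + (1 / B) * (\<integral>\<omega>. Y \<omega> * indicator A (X \<omega>) \<partial>M)"
  proof (subst Bochner_Integration.integral_add)
    show "integrable M (\<lambda>\<omega>. indicator A (X \<omega>) :: real)"
      by (rule integrable_bounded[of _ 1]) (auto simp: indicator_def)
    show "integrable M (\<lambda>\<omega>. 1 / B * (Y \<omega> * indicator A (X \<omega>)))"
      by (intro integrable_mult_right integrable_bounded[of _ C])
        (use bd in \<open>force simp: indicator_def\<close>)+
  qed auto
  finally show ?thesis using B by simp
qed

text \<open>
  Conjugating the integrand and replacing \<open>u\<close> by \<open>-u\<close> shows that the hypothesis passes to the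
  conjugate of \<open>Y\<close>, and therefore to its real and imaginary parts.
\<close>
lemma (in prob_space) fourier_zero_imp_indicator_zero:
  fixes Y :: "'a \<Rightarrow> complex" and X :: "'a \<Rightarrow> real"
  assumes [measurable]: "Y \<in> borel_measurable M" "X \<in> borel_measurable M"
    and bd: "\<And>\<omega>. \<omega> \<in> space M \<Longrightarrow> norm (Y \<omega>) \<le> C"
    and zero: "\<And>u. (\<integral>\<omega>. Y \<omega> * cis (u * X \<omega>) \<partial>M) = 0"
    and A [measurable]: "A \<in> sets borel"
  shows "(\<integral>\<omega>. Y \<omega> * indicator A (X \<omega>) \<partial>M) = 0"
proof -
  have [measurable]: "(\<lambda>\<omega>. Re (Y \<omega>)) \<in> borel_measurable M" "(\<lambda>\<omega>. Im (Y \<omega>)) \<in> borel_measurable M"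
    by auto
  have int: "integrable M (\<lambda>\<omega>. Y \<omega> * cis (u * X \<omega>))" for u
    by (rule integrable_bounded[of _ C]) (use bd in \<open>auto simp: norm_mult cis_conv_exp\<close>)
  have [measurable]: "(\<lambda>\<omega>. cnj (Y \<omega>)) \<in> borel_measurable M"
    by (rule borel_measurable_continuous_on[of cnj]) (auto intro: continuous_intros)
  have cint: "integrable M (\<lambda>\<omega>. cnj (Y \<omega>) * cis (u * X \<omega>))" for u
    by (rule integrable_bounded[of _ C]) (use bd in \<open>auto simp: norm_mult cis_conv_exp\<close>)
  have czero: "(\<integral>\<omega>. cnj (Y \<omega>) * cis (u * X \<omega>) \<partial>M) = 0" for u
  proof -
    have "(\<integral>\<omega>. cnj (Y \<omega>) * cis (u * X \<omega>) \<partial>M) = (\<integral>\<omega>. cnj (Y \<omega> * cis (- u * X \<omega>)) \<partial>M)"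
      by (simp add: cis_cnj)
    also have "\<dots> = cnj (\<integral>\<omega>. Y \<omega> * cis (- u * X \<omega>) \<partial>M)"
      by (rule Bochner_Integration.integral_cnj)
    finally show ?thesis using zero[of "- u"] by simp
  qed
  have re: "(\<integral>\<omega>. Re (Y \<omega>) * indicator A (X \<omega>) \<partial>M) = 0"
  proof (rule fourier_zero_imp_indicator_zero_real[of _ _ C])
    show "\<bar>Re (Y \<omega>)\<bar> \<le> C" if "\<omega> \<in> space M" for \<omega>
      using bd[OF that] abs_Re_le_cmod[of "Y \<omega>"] by linarith
    have "(\<integral>\<omega>. complex_of_real (Re (Y \<omega>)) * cis (u * X \<omega>) \<partial>M)
        = (\<integral>\<omega>. (1/2) * (Y \<omega> * cis (u * X \<omega>) + cnj (Y \<omega>) * cis (u * X \<omega>)) \<partial>M)" for u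
      by (intro Bochner_Integration.integral_cong) (auto simp: complex_eq_iff)
    then show "(\<integral>\<omega>. complex_of_real (Re (Y \<omega>)) * cis (u * X \<omega>) \<partial>M) = 0" for u
      using int cint zero czero by simp
  qed auto
  have im: "(\<integral>\<omega>. Im (Y \<omega>) * indicator A (X \<omega>) \<partial>M) = 0"
  proof (rule fourier_zero_imp_indicator_zero_real[of _ _ C])
    show "\<bar>Im (Y \<omega>)\<bar> \<le> C" if "\<omega> \<in> space M" for \<omega>
      using bd[OF that] abs_Im_le_cmod[of "Y \<omega>"] by linarith
    have "(\<integral>\<omega>. complex_of_real (Im (Y \<omega>)) * cis (u * X \<omega>) \<partial>M)
        = (\<integral>\<omega>. (- \<i>/2) * (Y \<omega> * cis (u * X \<omega>) - cnj (Y \<omega>) * cis (u * X \<omega>)) \<partial>M)" for u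
      by (intro Bochner_Integration.integral_cong) (auto simp: complex_eq_iff)
    then show "(\<integral>\<omega>. complex_of_real (Im (Y \<omega>)) * cis (u * X \<omega>) \<partial>M) = 0" for u
      using int cint zero czero by simp
  qed auto
  have "integrable M (\<lambda>\<omega>. Y \<omega> * indicator A (X \<omega>))"
  proof (rule integrable_bounded[of _ C])
    show "norm (Y \<omega> * indicator A (X \<omega>)) \<le> C" if "\<omega> \<in> space M" for \<omega>
      using bd[OF that] order_trans[OF norm_ge_zero bd[OF that]] by (auto simp: indicator_def)
  qed measurable
  moreover have "(\<lambda>\<omega>. Y \<omega> * indicator A (X \<omega>)) = (\<lambda>\<omega>. Y \<omega> * complex_of_real (indicat_real A (X \<omega>)))"
    by (auto simp: indicator_def)
  ultimately show ?thesis
    using re im Re_Im_integral_mult_of_real[of M Y "\<lambda>\<omega>. indicat_real A (X \<omega>)"]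
    by (simp only: complex_eq_iff zero_complex.sel)
qed

text \<open>
  Exponentials are traded for indicators one coordinate at a time: the exponentials of the remaining
  coordinates are absorbed into the weight \<open>Y\<close>, which is why complex weights are allowed.
\<close>
lemma (in prob_space) fourier_zero_imp_cylinder_zero:
  fixes Y :: "'a \<Rightarrow> complex" and X :: "'i \<Rightarrow> 'a \<Rightarrow> real"
  assumes "finite F"
    and "Y \<in> borel_measurable M" "\<And>\<omega>. \<omega> \<in> space M \<Longrightarrow> norm (Y \<omega>) \<le> C"
    and X: "\<And>j. j \<in> F \<Longrightarrow> X j \<in> borel_measurable M"
    and "\<And>u. (\<integral>\<omega>. Y \<omega> * cis (\<Sum>j\<in>F. u j * X j \<omega>) \<partial>M) = 0"
    and A: "\<And>j. j \<in> F \<Longrightarrow> A j \<in> sets borel"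
  shows "(\<integral>\<omega>. Y \<omega> * (\<Prod>j\<in>F. indicator (A j) (X j \<omega>)) \<partial>M) = 0"
  using assms
proof (induction F arbitrary: Y rule: finite_induct)
  case empty
  then show ?case by simp
next
  case (insert j F)
  note Y [measurable] = insert.prems(1) and bd = insert.prems(2)
  have [measurable]: "X i \<in> borel_measurable M" if "i \<in> insert j F" for i
    using insert.prems that by auto
  have [measurable]: "A j \<in> sets borel" using insert.prems by auto
  have [measurable]: "X j \<in> borel_measurable M" by simp
  have "(\<integral>\<omega>. (Y \<omega> * indicator (A j) (X j \<omega>)) * (\<Prod>j\<in>F. indicator (A j) (X j \<omega>)) \<partial>M) = 0"
  proof (rule insert.IH)
    show "(\<lambda>\<omega>. Y \<omega> * indicator (A j) (X j \<omega>)) \<in> borel_measurable M" by measurable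
    show "norm (Y \<omega> * indicator (A j) (X j \<omega>)) \<le> C" if "\<omega> \<in> space M" for \<omega>
      using bd[OF that] norm_ge_zero[of "Y \<omega>"] by (auto simp: indicator_def simp del: norm_ge_zero)
    fix u
    have s: "(\<Sum>i\<in>insert j F. (u(j := v)) i * X i \<omega>) = v * X j \<omega> + (\<Sum>i\<in>F. u i * X i \<omega>)" for v \<omega>
      using insert.hyps by (auto intro!: sum.cong)
    have "(\<integral>\<omega>. (Y \<omega> * cis (\<Sum>i\<in>F. u i * X i \<omega>)) * indicator (A j) (X j \<omega>) \<partial>M) = 0"
    proof (rule fourier_zero_imp_indicator_zero[of _ _ C])
      show "(\<lambda>\<omega>. Y \<omega> * cis (\<Sum>i\<in>F. u i * X i \<omega>)) \<in> borel_measurable M"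
        by (simp add: cis_conv_exp)
      show "norm (Y \<omega> * cis (\<Sum>i\<in>F. u i * X i \<omega>)) \<le> C" if "\<omega> \<in> space M" for \<omega>
        using bd[OF that] by (simp add: norm_mult)
      show "(\<integral>\<omega>. (Y \<omega> * cis (\<Sum>i\<in>F. u i * X i \<omega>)) * cis (v * X j \<omega>) \<partial>M) = 0" for v
        using insert.prems(4)[of "u(j := v)"] unfolding s
        by (simp add: cis_mult[symmetric] mult_ac)
    qed auto
    then show "(\<integral>\<omega>. (Y \<omega> * indicator (A j) (X j \<omega>)) * cis (\<Sum>i\<in>F. u i * X i \<omega>) \<partial>M) = 0"
      by (simp add: mult_ac)
  qed (use insert.prems in auto)
  then show ?case using insert.hyps by (simp add: mult_ac)
qed

definition generated_algebra :: "'a measure \<Rightarrow> ('i \<Rightarrow> 'a \<Rightarrow> real) \<Rightarrow> 'i set \<Rightarrow> 'a measure" where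
  "generated_algebra M X J = vimage_algebra (space M) (\<lambda>\<omega>. \<lambda>j\<in>J. X j \<omega>) (\<Pi>\<^sub>M j\<in>J. borel)"

lemma space_generated_algebra [simp]: "space (generated_algebra M X J) = space M"
  by (simp add: generated_algebra_def)

lemma measurable_generated_algebra: "j \<in> J \<Longrightarrow> X j \<in> borel_measurable (generated_algebra M X J)"
proof -
  assume j: "j \<in> J"
  have [measurable]: "(\<lambda>\<omega>. \<lambda>j\<in>J. X j \<omega>) \<in> generated_algebra M X J \<rightarrow>\<^sub>M (\<Pi>\<^sub>M j\<in>J. borel)"
    unfolding generated_algebra_def by (rule measurable_vimage_algebra1) (auto simp: space_PiM)
  have "(\<lambda>\<omega>. (\<lambda>j\<in>J. X j \<omega>) j) \<in> borel_measurable (generated_algebra M X J)"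
    by (rule measurable_compose[OF _ measurable_component_singleton[OF j]]) measurable
  then show ?thesis using j by simp
qed

lemma sets_generated_algebra_le:
  assumes "\<And>j. j \<in> J \<Longrightarrow> X j \<in> borel_measurable M"
  shows "sets (generated_algebra M X J) \<subseteq> sets M"
proof -
  have "(\<lambda>\<omega>. \<lambda>j\<in>J. X j \<omega>) \<in> M \<rightarrow>\<^sub>M (\<Pi>\<^sub>M j\<in>J. borel)"
    using assms by (intro measurable_restrict) auto
  then show ?thesis
    unfolding generated_algebra_def by (intro sets_image_in_sets) auto
qed

text \<open>
  Adding the constant \<open>C\<close> makes the weight nonnegative. The weights \<open>C + Y\<close> and \<open>C\<close> then give two
  finite measures whose images under the family \<open>X\<close> agree on cylinders, an intersection-stable
  generator.
\<close>
lemma (in prob_space) integral_zero_from_cylinders: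
  fixes Y :: "'a \<Rightarrow> real" and X :: "'i \<Rightarrow> 'a \<Rightarrow> real"
  assumes [measurable]: "Y \<in> borel_measurable M" and bd: "\<And>\<omega>. \<omega> \<in> space M \<Longrightarrow> \<bar>Y \<omega>\<bar> \<le> C"
    and X [measurable]: "\<And>j. j \<in> J \<Longrightarrow> X j \<in> borel_measurable M"
    and zero: "\<And>F A. finite F \<Longrightarrow> F \<subseteq> J \<Longrightarrow> (\<And>j. j \<in> F \<Longrightarrow> A j \<in> sets borel) \<Longrightarrow>
        (\<integral>\<omega>. Y \<omega> * (\<Prod>j\<in>F. indicator (A j) (X j \<omega>)) \<partial>M) = 0"
    and E: "E \<in> sets (generated_algebra M X J)"
  shows "(\<integral>\<omega>. Y \<omega> * indicator E \<omega> \<partial>M) = 0"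
proof -
  obtain \<omega>0 where "\<omega>0 \<in> space M" using not_empty by auto
  have C0: "C \<ge> 0" using bd[OF \<open>\<omega>0 \<in> space M\<close>] by auto
  let ?X = "\<lambda>\<omega>. \<lambda>j\<in>J. X j \<omega>"
  have mX [measurable]: "?X \<in> M \<rightarrow>\<^sub>M (\<Pi>\<^sub>M j\<in>J. borel)"
    using X by (intro measurable_restrict) auto
  have intY: "integrable M (\<lambda>\<omega>. Y \<omega> * indicator S \<omega>)" if "S \<in> sets M" for S
    by (rule integrable_bounded[of _ C]) (use bd C0 that in \<open>auto simp: indicator_def\<close>)
  have EC: "(\<integral>\<omega>. (C + Y \<omega>) * indicator S \<omega> \<partial>M) = C * measure M S + (\<integral>\<omega>. Y \<omega> * indicator S \<omega> \<partial>M)"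
    if [measurable]: "S \<in> sets M" for S
  proof -
    have "integrable M (\<lambda>\<omega>. C * indicat_real S \<omega>)"
      by (intro integrable_mult_right) (auto simp: emeasure_eq_measure)
    from Bochner_Integration.integral_add[OF this intY[OF that]] show ?thesis
      by (simp add: distrib_right)
  qed
  define D1 where "D1 = density M (\<lambda>\<omega>. ennreal (C + Y \<omega>))"
  define D2 where "D2 = density M (\<lambda>\<omega>. ennreal C)"
  have [measurable_cong]: "sets D1 = sets M" "sets D2 = sets M" by (auto simp: D1_def D2_def)
  have D1: "emeasure D1 S = ennreal (C * measure M S + (\<integral>\<omega>. Y \<omega> * indicator S \<omega> \<partial>M))" if S [measurable]: "S \<in> sets M" for S
  proof -
    have int: "integrable M (\<lambda>\<omega>. (C + Y \<omega>) * indicator S \<omega>)"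
      using intY[OF S] unfolding distrib_right
      by (intro Bochner_Integration.integrable_add integrable_mult_right) (auto simp: emeasure_eq_measure)
    have "emeasure D1 S = (\<integral>\<^sup>+\<omega>. ennreal ((C + Y \<omega>) * indicator S \<omega>) \<partial>M)"
      unfolding D1_def by (subst emeasure_density) (auto intro!: nn_integral_cong simp: indicator_def)
    also have "\<dots> = ennreal (\<integral>\<omega>. (C + Y \<omega>) * indicator S \<omega> \<partial>M)"
      using bd by (intro nn_integral_eq_integral int) (force simp: indicator_def intro!: AE_I2)
    also have "(\<integral>\<omega>. (C + Y \<omega>) * indicator S \<omega> \<partial>M) = C * measure M S + (\<integral>\<omega>. Y \<omega> * indicator S \<omega> \<partial>M)"
      by (rule EC) fact
    finally show ?thesis .
  qed
  have D2: "emeasure D2 S = ennreal (C * measure M S)" if S [measurable]: "S \<in> sets M" for S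
    unfolding D2_def by (subst emeasure_density_const) (auto simp: emeasure_eq_measure ennreal_mult C0)
  have eq: "distr D1 (\<Pi>\<^sub>M j\<in>J. borel) ?X = distr D2 (\<Pi>\<^sub>M j\<in>J. borel) ?X"
  proof (rule measure_eqI_PiM_infinite)
    show "finite_measure (distr D1 (\<Pi>\<^sub>M j\<in>J. borel) ?X)"
    proof
      have "emeasure D1 (space M) \<noteq> \<infinity>" by (subst D1) auto
      moreover have "?X -` space (\<Pi>\<^sub>M j\<in>J. borel :: real measure) \<inter> space D1 = space M"
        using measurable_space[OF mX] by (auto simp: D1_def)
      moreover have "?X \<in> D1 \<rightarrow>\<^sub>M (\<Pi>\<^sub>M j\<in>J. borel)" by measurable
      ultimately show "emeasure (distr D1 (\<Pi>\<^sub>M j\<in>J. borel) ?X) (space (distr D1 (\<Pi>\<^sub>M j\<in>J. borel) ?X)) \<noteq> \<infinity>"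
        by (simp only: emeasure_distr space_distr sets.top not_False_eq_True)
    qed
    fix A F assume F: "finite F" "F \<subseteq> J" and A: "\<And>j. j \<in> F \<Longrightarrow> A j \<in> sets (borel :: real measure)"
    let ?E = "prod_emb J (\<lambda>_. borel :: real measure) F (Pi\<^sub>E F A)"
    have E [measurable]: "?E \<in> sets (\<Pi>\<^sub>M j\<in>J. borel)" using F A by (intro sets_PiM_I) auto
    define S where "S = ?X -` ?E \<inter> space M"
    have [measurable]: "S \<in> sets M" unfolding S_def by (rule measurable_sets[OF mX E])
    have iS: "indicator S \<omega> = (\<Prod>j\<in>F. indicator (A j) (X j \<omega>) :: real)" if "\<omega> \<in> space M" for \<omega>
    proof -
      have "\<omega> \<in> S \<longleftrightarrow> (\<forall>j\<in>F. X j \<omega> \<in> A j)"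
        using that F(2) by (auto simp: S_def prod_emb_def restrict_def PiE_iff extensional_def subset_eq)
      then show ?thesis
        by (cases "\<omega> \<in> S") (auto simp: indicator_def F(1))
    qed
    have "(\<integral>\<omega>. Y \<omega> * indicator S \<omega> \<partial>M) = (\<integral>\<omega>. Y \<omega> * (\<Prod>j\<in>F. indicator (A j) (X j \<omega>)) \<partial>M)"
      by (intro Bochner_Integration.integral_cong) (auto simp: iS)
    then have "emeasure D1 S = emeasure D2 S"
      using zero[OF F A] by (simp add: D1 D2)
    then show "emeasure (distr D1 (\<Pi>\<^sub>M j\<in>J. borel) ?X) ?E = emeasure (distr D2 (\<Pi>\<^sub>M j\<in>J. borel) ?X) ?E"
      by (simp add: emeasure_distr S_def D1_def D2_def)
  qed auto
  obtain B where B: "B \<in> sets (\<Pi>\<^sub>M j\<in>J. borel)" "E = ?X -` B \<inter> space M"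
    using E unfolding generated_algebra_def by (subst (asm) sets_vimage_algebra2) (auto simp: space_PiM)
  have E': "E \<in> sets M" using B by auto
  have "emeasure (distr D1 (\<Pi>\<^sub>M j\<in>J. borel) ?X) B = emeasure D1 E"
    "emeasure (distr D2 (\<Pi>\<^sub>M j\<in>J. borel) ?X) B = emeasure D2 E"
    using B by (auto simp: emeasure_distr D1_def D2_def)
  then have "emeasure D1 E = emeasure D2 E" using eq by simp
  then have e: "ennreal (C * measure M E + (\<integral>\<omega>. Y \<omega> * indicator E \<omega> \<partial>M)) = ennreal (C * measure M E)"
    using E' by (simp add: D1 D2)
  have "(\<integral>\<omega>. (C + Y \<omega>) * indicator E \<omega> \<partial>M) \<ge> 0"
    using bd by (intro integral_nonneg_AE AE_I2) (force simp: indicator_def)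
  then have "C * measure M E + (\<integral>\<omega>. Y \<omega> * indicator E \<omega> \<partial>M) \<ge> 0"
    using EC[OF E'] by simp
  then show ?thesis using e C0 by (subst (asm) ennreal_inj) auto
qed

text \<open>The hypothesis says that the conditional expectation of \<open>Y\<close> given \<open>N\<close> vanishes.\<close>
lemma (in prob_space) integral_zero_from_subalgebra_sets:
  fixes Y Z :: "'a \<Rightarrow> real"
  assumes N: "subalgebra M N"
    and [measurable]: "Y \<in> borel_measurable M" and bd: "\<And>\<omega>. \<omega> \<in> space M \<Longrightarrow> \<bar>Y \<omega>\<bar> \<le> C"
    and zero: "\<And>E. E \<in> sets N \<Longrightarrow> (\<integral>\<omega>. Y \<omega> * indicator E \<omega> \<partial>M) = 0"
    and Z: "Z \<in> borel_measurable N" and bdZ: "\<And>\<omega>. \<omega> \<in> space M \<Longrightarrow> \<bar>Z \<omega>\<bar> \<le> B"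
  shows "(\<integral>\<omega>. Y \<omega> * Z \<omega> \<partial>M) = 0"
proof -
  interpret finite_measure_subalgebra M N by unfold_locales (rule N)
  have [measurable]: "Z \<in> borel_measurable M" by (rule measurable_from_subalg[OF N Z])
  have "AE \<omega> in M. real_cond_exp M N Y \<omega> = 0"
  proof (rule real_cond_exp_charact)
    show "(\<integral>\<omega>\<in>E. Y \<omega> \<partial>M) = (\<integral>\<omega>\<in>E. 0 \<partial>M)" if "E \<in> sets N" for E
      using zero[OF that] by (simp add: set_lebesgue_integral_def mult.commute)
    show "integrable M Y"
      by (rule integrable_bounded[of _ C]) (use bd in auto)
  qed auto
  moreover have "integrable M (\<lambda>\<omega>. Z \<omega> * Y \<omega>)"
  proof (rule integrable_bounded[of _ "B * C"])
    show "norm (Z \<omega> * Y \<omega>) \<le> B * C" if "\<omega> \<in> space M" for \<omega>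
      unfolding real_norm_def abs_mult
      by (rule mult_mono) (use bd[OF that] bdZ[OF that] in auto)
  qed auto
  ultimately have "(\<integral>\<omega>. Z \<omega> * Y \<omega> \<partial>M) = (\<integral>\<omega>. Z \<omega> * real_cond_exp M N Y \<omega> \<partial>M)"
    using Z by (subst real_cond_exp_intg(2)) auto
  also have "\<dots> = (\<integral>\<omega>. 0 \<partial>M)"
  proof (rule integral_cong_AE)
    show "AE \<omega> in M. Z \<omega> * real_cond_exp M N Y \<omega> = 0"
      using \<open>AE \<omega> in M. real_cond_exp M N Y \<omega> = 0\<close> by eventually_elim simp
  qed auto
  finally show ?thesis by (simp add: mult.commute)
qed

lemma subalgebra_generated_algebra:
  assumes "\<And>j. j \<in> J \<Longrightarrow> X j \<in> borel_measurable M"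
  shows "subalgebra M (generated_algebra M X J)"
  using sets_generated_algebra_le[OF assms] by (simp add: subalgebra_def)

text \<open>
  This is uniqueness of Fourier transforms for arbitrary families, in the form in which all
  independence statements below use it: the weight \<open>Y\<close> is the difference of two quantities
  whose equality on exponentials is known.
\<close>
proposition (in prob_space) fourier_zero_imp_orthogonal:
  fixes Y Z :: "'a \<Rightarrow> complex" and X :: "'i \<Rightarrow> 'a \<Rightarrow> real"
  assumes Y [measurable]: "Y \<in> borel_measurable M" and bd: "\<And>\<omega>. \<omega> \<in> space M \<Longrightarrow> norm (Y \<omega>) \<le> C"
    and X [measurable]: "\<And>j. j \<in> J \<Longrightarrow> X j \<in> borel_measurable M"
    and zero: "\<And>F u. finite F \<Longrightarrow> F \<subseteq> J \<Longrightarrow> (\<integral>\<omega>. Y \<omega> * cis (\<Sum>j\<in>F. u j * X j \<omega>) \<partial>M) = 0"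
    and Z: "Z \<in> borel_measurable (generated_algebra M X J)" and bdZ: "\<And>\<omega>. \<omega> \<in> space M \<Longrightarrow> norm (Z \<omega>) \<le> B"
  shows "(\<integral>\<omega>. Y \<omega> * Z \<omega> \<partial>M) = 0"
proof -
  note sub = subalgebra_generated_algebra[of J X M, OF X]
  have [measurable]: "Z \<in> borel_measurable M" by (rule measurable_from_subalg[OF sub Z])
  have B0: "B \<ge> 0" using bdZ not_empty norm_ge_zero order_trans by blast
  have C0: "C \<ge> 0" using bd not_empty norm_ge_zero order_trans by blast
  have *: "(\<integral>\<omega>. p (Y \<omega>) * r (Z \<omega>) \<partial>M) = 0"
    if pr: "p = Re \<or> p = Im" "r = Re \<or> r = Im" for p r :: "complex \<Rightarrow> real"
  proof (rule integral_zero_from_subalgebra_sets[OF sub])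
    have le: "\<bar>p z\<bar> \<le> norm z" "\<bar>r z\<bar> \<le> norm z" for z
      using pr abs_Re_le_cmod abs_Im_le_cmod by auto
    show "\<bar>p (Y \<omega>)\<bar> \<le> C" if "\<omega> \<in> space M" for \<omega> using bd[OF that] le by (meson order_trans)
    show "\<bar>r (Z \<omega>)\<bar> \<le> B" if "\<omega> \<in> space M" for \<omega> using bdZ[OF that] le by (meson order_trans)
    show pY [measurable]: "(\<lambda>\<omega>. p (Y \<omega>)) \<in> borel_measurable M" using pr by auto
    show "(\<lambda>\<omega>. r (Z \<omega>)) \<in> borel_measurable (generated_algebra M X J)" using pr Z by auto
    show "(\<integral>\<omega>. p (Y \<omega>) * indicator E \<omega> \<partial>M) = 0" if "E \<in> sets (generated_algebra M X J)" for E
    proof (rule integral_zero_from_cylinders[OF pY _ X _ that])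
      show "\<bar>p (Y \<omega>)\<bar> \<le> C" if "\<omega> \<in> space M" for \<omega> using bd[OF that] le by (meson order_trans)
      fix F and A :: "'i \<Rightarrow> real set"
      assume F: "finite F" "F \<subseteq> J" and A: "\<And>j. j \<in> F \<Longrightarrow> A j \<in> sets borel"
      let ?I = "\<lambda>\<omega>. \<Prod>j\<in>F. indicator (A j) (X j \<omega>)"
      have [measurable]: "X j \<in> borel_measurable M" "A j \<in> sets borel" if "j \<in> F" for j using that F A by auto
      have z: "(\<integral>\<omega>. Y \<omega> * ?I \<omega> \<partial>M) = 0"
        using F A X by (intro fourier_zero_imp_cylinder_zero[OF F(1) Y bd _ zero]) auto
      have Ir: "(?I \<omega> :: complex) = of_real (?I \<omega>)" for \<omega>
        by (auto simp: indicator_def of_real_prod intro!: prod.cong)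
      have I1: "\<bar>?I \<omega> :: real\<bar> \<le> 1" for \<omega>
        by (auto simp: abs_prod intro!: prod_le_1)
      have int: "integrable M (\<lambda>\<omega>. Y \<omega> * of_real (?I \<omega>))"
      proof (rule integrable_bounded[of _ C])
        show "norm (Y \<omega> * of_real (?I \<omega>)) \<le> C" if "\<omega> \<in> space M" for \<omega>
          using mult_mono[OF bd[OF that] I1[of \<omega>]] C0 by (simp add: norm_mult del: of_real_prod)
      qed measurable
      have "(\<integral>\<omega>. p (Y \<omega>) * ?I \<omega> \<partial>M) = p (\<integral>\<omega>. Y \<omega> * of_real (?I \<omega>) \<partial>M)"
        by (rule disjE[OF pr(1)]) (simp_all only: Re_Im_integral_mult_of_real[OF int])
      also have "\<dots> = 0" using z pr unfolding Ir by auto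
      finally show "(\<integral>\<omega>. p (Y \<omega>) * ?I \<omega> \<partial>M) = 0" .
    qed
  qed
  have intYZ: "integrable M (\<lambda>\<omega>. p (Y \<omega>) * r (Z \<omega>))"
    if pr: "p = Re \<or> p = Im" "r = Re \<or> r = Im" for p r :: "complex \<Rightarrow> real"
  proof (rule integrable_bounded[of _ "C * B"])
    show "(\<lambda>\<omega>. p (Y \<omega>) * r (Z \<omega>)) \<in> borel_measurable M" using pr by auto
    have le: "\<bar>p z\<bar> \<le> norm z" "\<bar>r z\<bar> \<le> norm z" for z
      using pr abs_Re_le_cmod abs_Im_le_cmod by auto
    show "norm (p (Y \<omega>) * r (Z \<omega>)) \<le> C * B" if "\<omega> \<in> space M" for \<omega>
      unfolding real_norm_def abs_mult using bd[OF that] bdZ[OF that] le C0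
      by (intro mult_mono) (meson order_trans abs_ge_zero)+
  qed
  have int: "integrable M (\<lambda>\<omega>. Y \<omega> * Z \<omega>)"
  proof (rule integrable_bounded[of _ "C * B"])
    show "norm (Y \<omega> * Z \<omega>) \<le> C * B" if "\<omega> \<in> space M" for \<omega>
      unfolding norm_mult using bd[OF that] bdZ[OF that] C0 by (intro mult_mono) auto
  qed measurable
  show ?thesis
  proof (rule complex_eqI)
    show "Re (\<integral>\<omega>. Y \<omega> * Z \<omega> \<partial>M) = Re 0"
      using * intYZ by (simp flip: integral_Re[OF int])
    show "Im (\<integral>\<omega>. Y \<omega> * Z \<omega> \<partial>M) = Im 0"
      using * intYZ by (simp flip: integral_Im[OF int])
  qed
qed

section \<open>Centered Gaussian processes: orthogonality is independence\<close>

text \<open>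
  Both kinds of Gaussian, normal and constant, have the same formula for the characteristic
  function; from here on the distinction matters only where a density is required.
\<close>
lemma (in prob_space) gaussian_rv_centered:
  assumes "gaussian_rv M L" and E0: "(\<integral>\<omega>. L \<omega> \<partial>M) = 0"
  shows "integrable M (\<lambda>\<omega>. (L \<omega>)\<^sup>2)" (is ?int)
    and "(\<integral>\<omega>. cis (L \<omega>) \<partial>M) = complex_of_real (exp (- (\<integral>\<omega>. (L \<omega>)\<^sup>2 \<partial>M) / 2))" (is ?char)
proof -
  have [measurable]: "L \<in> borel_measurable M" using assms by (simp add: gaussian_rv_def)
  consider (normal) \<mu> \<sigma> where "\<sigma> > 0" "distributed M lborel L (normal_density \<mu> \<sigma>)"
    | (const) \<mu> where "AE \<omega> in M. L \<omega> = \<mu>"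
    using assms(1) unfolding gaussian_rv_def by blast
  then have "?int \<and> ?char"
  proof cases
    case normal
    then have "\<mu> = 0" using normal_distributed_expectation[OF normal] E0 by simp
    note N = normal[unfolded \<open>\<mu> = 0\<close>]
    have var: "(\<integral>\<omega>. (L \<omega>)\<^sup>2 \<partial>M) = \<sigma>\<^sup>2"
      using normal_distributed_variance[OF N] E0 by simp
    have int: ?int
    proof (rule ccontr)
      assume "\<not> ?int"
      then have "\<sigma>\<^sup>2 = 0" using not_integrable_integral_eq var by metis
      then show False using N(1) by simp
    qed
    have S: "distributed M lborel (\<lambda>x. L x / \<sigma>) std_normal_density"
      using normal_standard_normal_convert[OF N(1), of L 0] N(2) by simp
    have "distr M borel (\<lambda>x. L x / \<sigma>) = std_normal_distribution"
      using distributed_distr_eq_density[OF S] by (simp cong: distr_cong)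
    then have "char (distr M borel (\<lambda>x. L x / \<sigma>)) \<sigma> = complex_of_real (exp (- (\<sigma>\<^sup>2) / 2))"
      by (simp add: char_std_normal_distribution)
    also have "char (distr M borel (\<lambda>x. L x / \<sigma>)) \<sigma> = (\<integral>\<omega>. cis (L \<omega>) \<partial>M)"
      using N(1) by (simp add: char_def integral_distr cis_conv_exp)
    finally show ?thesis using int var by simp
  next
    case const
    have "(\<integral>\<omega>. L \<omega> \<partial>M) = (\<integral>\<omega>. \<mu> \<partial>M)" by (rule integral_cong_AE) (use const in auto)
    then have mu: "\<mu> = 0" using E0 by (simp add: prob_space)
    have 1: "AE \<omega> in M. (L \<omega>)\<^sup>2 = 0" using const unfolding mu by eventually_elim simp
    have 2: "AE \<omega> in M. cis (L \<omega>) = 1" using const unfolding mu by eventually_elim simp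
    have "(\<integral>\<omega>. (L \<omega>)\<^sup>2 \<partial>M) = (\<integral>\<omega>. 0 \<partial>M)" by (rule integral_cong_AE) (use 1 in auto)
    moreover have "(\<integral>\<omega>. cis (L \<omega>) \<partial>M) = (\<integral>\<omega>. 1 \<partial>M)"
      by (rule integral_cong_AE) (use 2 in \<open>auto simp: cis_conv_exp\<close>)
    moreover have ?int
      by (rule integrable_cong_AE_imp[of M "\<lambda>_. 0"]) (use 1 in auto)
    ultimately show ?thesis by (simp add: prob_space)
  qed
  then show ?int ?char by auto
qed

definition lin_comb :: "('i \<Rightarrow> 'a \<Rightarrow> real) \<Rightarrow> 'i set \<Rightarrow> ('a \<Rightarrow> real) set" where
  "lin_comb W T = {\<lambda>\<omega>. \<Sum>t\<in>J. a t * W t \<omega> | J a. finite J \<and> J \<subseteq> T}"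

lemma lin_comb_sumI: "finite J \<Longrightarrow> J \<subseteq> T \<Longrightarrow> (\<lambda>\<omega>. \<Sum>t\<in>J. a t * W t \<omega>) \<in> lin_comb W T"
  by (auto simp: lin_comb_def)

lemma lin_comb_base: "t \<in> T \<Longrightarrow> W t \<in> lin_comb W T"
  using lin_comb_sumI[of "{t}" T "\<lambda>_. 1" W] by simp

lemma lin_comb_zero: "(\<lambda>\<omega>. 0) \<in> lin_comb W T"
  using lin_comb_sumI[of "{}" T "\<lambda>_. 1" W] by simp

lemma lin_comb_scale:
  assumes "L \<in> lin_comb W T"
  shows "(\<lambda>\<omega>. c * L \<omega>) \<in> lin_comb W T"
proof -
  obtain J a where "finite J" "J \<subseteq> T" "L = (\<lambda>\<omega>. \<Sum>t\<in>J. a t * W t \<omega>)"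
    using assms unfolding lin_comb_def by blast
  then show ?thesis
    using lin_comb_sumI[of J T "\<lambda>t. c * a t" W] by (simp add: sum_distrib_left mult.assoc)
qed

lemma lin_comb_add:
  assumes "L1 \<in> lin_comb W T" "L2 \<in> lin_comb W T"
  shows "(\<lambda>\<omega>. L1 \<omega> + L2 \<omega>) \<in> lin_comb W T"
proof -
  obtain J1 a1 J2 a2 where *: "finite J1" "J1 \<subseteq> T" "L1 = (\<lambda>\<omega>. \<Sum>t\<in>J1. a1 t * W t \<omega>)"
    "finite J2" "J2 \<subseteq> T" "L2 = (\<lambda>\<omega>. \<Sum>t\<in>J2. a2 t * W t \<omega>)"
    using assms unfolding lin_comb_def by blast
  let ?a = "\<lambda>t. (if t \<in> J1 then a1 t else 0) + (if t \<in> J2 then a2 t else 0)"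
  have "(\<Sum>t\<in>J1. a1 t * W t \<omega>) = (\<Sum>t\<in>J1 \<union> J2. (if t \<in> J1 then a1 t else 0) * W t \<omega>)"
    "(\<Sum>t\<in>J2. a2 t * W t \<omega>) = (\<Sum>t\<in>J1 \<union> J2. (if t \<in> J2 then a2 t else 0) * W t \<omega>)" for \<omega>
    using *(1,4) by (auto intro!: sum.mono_neutral_cong_left)
  then have "(\<lambda>\<omega>. L1 \<omega> + L2 \<omega>) = (\<lambda>\<omega>. \<Sum>t\<in>J1 \<union> J2. ?a t * W t \<omega>)"
    by (simp add: * distrib_right sum.distrib)
  then show ?thesis using lin_comb_sumI[of "J1 \<union> J2" T ?a W] * by simp
qed

lemma lin_comb_diff:
  "L1 \<in> lin_comb W T \<Longrightarrow> L2 \<in> lin_comb W T \<Longrightarrow> (\<lambda>\<omega>. L1 \<omega> - L2 \<omega>) \<in> lin_comb W T"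
  using lin_comb_add[OF _ lin_comb_scale[of L2 W T "-1"]] by simp

lemma lin_comb_sum:
  assumes "finite F" "\<And>j. j \<in> F \<Longrightarrow> L j \<in> lin_comb W T"
  shows "(\<lambda>\<omega>. \<Sum>j\<in>F. c j * L j \<omega>) \<in> lin_comb W T"
  using assms
proof (induction F rule: finite_induct)
  case empty
  then show ?case by (simp add: lin_comb_zero)
next
  case (insert j F)
  have "(\<lambda>\<omega>. c j * L j \<omega> + (\<Sum>j\<in>F. c j * L j \<omega>)) \<in> lin_comb W T"
    using insert by (intro lin_comb_add[OF lin_comb_scale]) simp_all
  then show ?case using insert.hyps by simp
qed

locale centered_gaussian_process = prob_space M for M :: "'a measure" +
  fixes T :: "real set" and W :: "real \<Rightarrow> 'a \<Rightarrow> real"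
  assumes gaussian: "gaussian_process M T W"
    and centered: "\<And>t. t \<in> T \<Longrightarrow> (\<integral>\<omega>. W t \<omega> \<partial>M) = 0"
begin

abbreviation inner_E :: "('a \<Rightarrow> real) \<Rightarrow> ('a \<Rightarrow> real) \<Rightarrow> real" where
  "inner_E L L' \<equiv> (\<integral>\<omega>. L \<omega> * L' \<omega> \<partial>M)"

lemma W_measurable [measurable]: "t \<in> T \<Longrightarrow> W t \<in> borel_measurable M"
  using gaussian by (simp add: gaussian_process_def)

lemma gaussian_lin: "L \<in> lin_comb W T \<Longrightarrow> gaussian_rv M L"
  using gaussian by (auto simp: gaussian_process_def lin_comb_def)

lemma lin_measurable: "L \<in> lin_comb W T \<Longrightarrow> L \<in> borel_measurable M"
  using gaussian_lin by (simp add: gaussian_rv_def)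

lemma square_integrable_W: "t \<in> T \<Longrightarrow> integrable M (\<lambda>\<omega>. (W t \<omega>)\<^sup>2)"
  by (rule gaussian_rv_centered(1)[OF gaussian_lin[OF lin_comb_base] centered])

lemma integrable_W: "t \<in> T \<Longrightarrow> integrable M (W t)"
  by (rule square_integrable_imp_integrable[OF W_measurable square_integrable_W])

lemma expectation_lin: "L \<in> lin_comb W T \<Longrightarrow> (\<integral>\<omega>. L \<omega> \<partial>M) = 0"
proof -
  assume "L \<in> lin_comb W T"
  then obtain J a where L: "finite J" "J \<subseteq> T" "L = (\<lambda>\<omega>. \<Sum>t\<in>J. a t * W t \<omega>)"
    by (auto simp: lin_comb_def)
  have "(\<integral>\<omega>. L \<omega> \<partial>M) = (\<Sum>t\<in>J. \<integral>\<omega>. a t * W t \<omega> \<partial>M)"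
    unfolding L(3) using L(2) integrable_W by (intro Bochner_Integration.integral_sum) auto
  also have "\<dots> = 0" using L(2) centered by (intro sum.neutral) auto
  finally show ?thesis .
qed

lemma square_integrable_lin: "L \<in> lin_comb W T \<Longrightarrow> integrable M (\<lambda>\<omega>. (L \<omega>)\<^sup>2)"
  using gaussian_rv_centered(1)[OF gaussian_lin expectation_lin] .

lemma char_lin:
  "L \<in> lin_comb W T \<Longrightarrow> (\<integral>\<omega>. cis (L \<omega>) \<partial>M) = complex_of_real (exp (- inner_E L L / 2))"
  using gaussian_rv_centered(2)[OF gaussian_lin expectation_lin] by (simp add: power2_eq_square)

lemma integrable_prod:
  assumes L: "L1 \<in> lin_comb W T" "L2 \<in> lin_comb W T"
  shows "integrable M (\<lambda>\<omega>. L1 \<omega> * L2 \<omega>)"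
proof -
  have "integrable M (\<lambda>\<omega>. (L1 \<omega> + L2 \<omega>)\<^sup>2 - (L1 \<omega>)\<^sup>2 - (L2 \<omega>)\<^sup>2)"
    by (rule Bochner_Integration.integrable_diff[OF Bochner_Integration.integrable_diff[OF
      square_integrable_lin[OF lin_comb_add[OF L]] square_integrable_lin[OF L(1)]]
      square_integrable_lin[OF L(2)]])
  from integrable_mult_right[OF this, of "1/2"] show ?thesis
    by (simp add: power2_eq_square algebra_simps)
qed

lemma inner_add_left:
  assumes "L1 \<in> lin_comb W T" "L2 \<in> lin_comb W T" "L3 \<in> lin_comb W T"
  shows "inner_E (\<lambda>\<omega>. L1 \<omega> + L2 \<omega>) L3 = inner_E L1 L3 + inner_E L2 L3"
  using integrable_prod assms by (simp add: distrib_right)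

lemma inner_diff_left:
  assumes "L1 \<in> lin_comb W T" "L2 \<in> lin_comb W T" "L3 \<in> lin_comb W T"
  shows "inner_E (\<lambda>\<omega>. L1 \<omega> - L2 \<omega>) L3 = inner_E L1 L3 - inner_E L2 L3"
  using integrable_prod assms by (simp add: left_diff_distrib)

lemma inner_scale_left: "inner_E (\<lambda>\<omega>. c * L1 \<omega>) L2 = c * inner_E L1 L2"
  by (simp add: mult.assoc)

lemma inner_sum_left:
  assumes "\<And>j. j \<in> F \<Longrightarrow> L j \<in> lin_comb W T" "L' \<in> lin_comb W T"
  shows "inner_E (\<lambda>\<omega>. \<Sum>j\<in>F. c j * L j \<omega>) L' = (\<Sum>j\<in>F. c j * inner_E (L j) L')"
proof -
  have "inner_E (\<lambda>\<omega>. \<Sum>j\<in>F. c j * L j \<omega>) L' = (\<integral>\<omega>. (\<Sum>j\<in>F. c j * (L j \<omega> * L' \<omega>)) \<partial>M)"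
    by (simp add: sum_distrib_right mult.assoc)
  also have "\<dots> = (\<Sum>j\<in>F. c j * inner_E (L j) L')"
    using assms integrable_prod by (subst Bochner_Integration.integral_sum) auto
  finally show ?thesis .
qed

lemma inner_commute: "inner_E L1 L2 = inner_E L2 L1"
  by (simp add: mult.commute)

text \<open>The variance of a sum of uncorrelated variables is additive and sits in the exponent.\<close>
lemma char_orthogonal:
  assumes L: "L1 \<in> lin_comb W T" "L2 \<in> lin_comb W T" and orth: "inner_E L1 L2 = 0"
  shows "(\<integral>\<omega>. cis (L1 \<omega>) * cis (L2 \<omega>) \<partial>M) = (\<integral>\<omega>. cis (L1 \<omega>) \<partial>M) * (\<integral>\<omega>. cis (L2 \<omega>) \<partial>M)"
proof -
  let ?S = "\<lambda>\<omega>. L1 \<omega> + L2 \<omega>"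
  have S: "?S \<in> lin_comb W T" by (rule lin_comb_add[OF L])
  have "inner_E ?S ?S = inner_E L1 ?S + inner_E L2 ?S" by (rule inner_add_left[OF L S])
  also have "inner_E L1 ?S = inner_E L1 L1 + inner_E L2 L1"
    unfolding inner_commute[of L1 ?S] by (rule inner_add_left[OF L L(1)])
  also have "inner_E L2 ?S = inner_E L1 L2 + inner_E L2 L2"
    unfolding inner_commute[of L2 ?S] inner_add_left[OF L L(2)] by simp
  finally have "inner_E ?S ?S = inner_E L1 L1 + inner_E L2 L2"
    using orth inner_commute[of L1 L2] by simp
  then have "(\<integral>\<omega>. cis (?S \<omega>) \<partial>M) = complex_of_real (exp (- inner_E L1 L1 / 2) * exp (- inner_E L2 L2 / 2))"
    unfolding char_lin[OF S] by (simp add: exp_add[symmetric] diff_divide_distrib add_divide_distrib)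
  then show ?thesis by (simp add: char_lin L cis_mult)
qed

lemma cis_lin_measurable:
  "L \<in> lin_comb W T \<Longrightarrow> (\<lambda>\<omega>. cis (L \<omega>)) \<in> borel_measurable M"
  using lin_measurable by (simp add: cis_conv_exp)

lemma integrable_cis_lin: "L \<in> lin_comb W T \<Longrightarrow> integrable M (\<lambda>\<omega>. cis (L \<omega>))"
  by (rule integrable_bounded[of _ 1]) (auto intro: cis_lin_measurable)

text \<open>
  The weight \<open>cis L - E (cis L)\<close> is annihilated by all exponentials of combinations of the
  \<open>W r\<close>, \<open>r \<in> J\<close>, hence by everything they generate.
\<close>
proposition orthogonal_char_factorises:
  assumes L: "L \<in> lin_comb W T" and J: "J \<subseteq> T"
    and orth: "\<And>r. r \<in> J \<Longrightarrow> inner_E L (W r) = 0"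
    and Z: "Z \<in> borel_measurable (generated_algebra M W J)" and bdZ: "\<And>\<omega>. \<omega> \<in> space M \<Longrightarrow> norm (Z \<omega>) \<le> B"
  shows "(\<integral>\<omega>. cis (L \<omega>) * Z \<omega> \<partial>M) = (\<integral>\<omega>. cis (L \<omega>) \<partial>M) * (\<integral>\<omega>. Z \<omega> \<partial>M)"
proof -
  define e where "e = (\<integral>\<omega>. cis (L \<omega>) \<partial>M)"
  note [measurable] = cis_lin_measurable[OF L]
  have WJ: "W j \<in> borel_measurable M" if "j \<in> J" for j using that J by auto
  have [measurable]: "Z \<in> borel_measurable M"
    by (rule measurable_from_subalg[OF subalgebra_generated_algebra[OF WJ] Z])
  have intZ: "integrable M Z" by (rule integrable_bounded[of _ B]) (use bdZ in auto)
  have intLZ: "integrable M (\<lambda>\<omega>. cis (L \<omega>) * Z \<omega>)"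
    by (rule integrable_bounded[of _ B]) (use bdZ in \<open>auto simp: norm_mult\<close>)
  have "(\<integral>\<omega>. (cis (L \<omega>) - e) * Z \<omega> \<partial>M) = 0"
  proof (rule fourier_zero_imp_orthogonal[OF _ _ WJ _ Z bdZ])
    show "norm (cis (L \<omega>) - e) \<le> 1 + norm e" for \<omega>
      using norm_triangle_ineq4[of "cis (L \<omega>)" e] by simp
    show "(\<integral>\<omega>. (cis (L \<omega>) - e) * cis (\<Sum>j\<in>F. u j * W j \<omega>) \<partial>M) = 0" if F: "finite F" "F \<subseteq> J" for F u
    proof -
      let ?L' = "\<lambda>\<omega>. \<Sum>j\<in>F. u j * W j \<omega>"
      have L': "?L' \<in> lin_comb W T" using F J by (intro lin_comb_sumI) auto
      have "inner_E ?L' L = (\<Sum>j\<in>F. u j * inner_E (W j) L)"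
        using F J by (intro inner_sum_left L lin_comb_base) auto
      also have "\<dots> = 0" using orth F by (intro sum.neutral) (auto simp: inner_commute[of _ L])
      finally have "inner_E L ?L' = 0" using inner_commute[of L ?L'] by simp
      from char_orthogonal[OF L L' this]
      have "(\<integral>\<omega>. cis (L \<omega>) * cis (?L' \<omega>) \<partial>M) = e * (\<integral>\<omega>. cis (?L' \<omega>) \<partial>M)" by (simp add: e_def)
      moreover have "integrable M (\<lambda>\<omega>. cis (L \<omega>) * cis (?L' \<omega>))"
        using integrable_cis_lin[OF lin_comb_add[OF L L']] by (simp add: cis_mult)
      ultimately show ?thesis
        using integrable_cis_lin[OF L'] by (simp add: left_diff_distrib)
    qed
  qed (use J in auto)
  then show ?thesis
    using intZ intLZ by (simp add: left_diff_distrib e_def)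
qed

text \<open>
  Independence is stated through the product of the laws, because Fubini's theorem consumes it in this
  form; here \<open>V\<close> takes values in an arbitrary space. The roles in the Fourier argument are
  swapped: now the weight is the centered indicator of an event about \<open>V\<close>, and the exponentials are
  those of \<open>L\<close>.
\<close>
proposition orthogonal_product_law:
  assumes L: "L \<in> lin_comb W T" and J: "J \<subseteq> T"
    and orth: "\<And>r. r \<in> J \<Longrightarrow> inner_E L (W r) = 0"
    and V: "V \<in> generated_algebra M W J \<rightarrow>\<^sub>M N"
  shows "distr M borel L \<Otimes>\<^sub>M distr M N V = distr M (borel \<Otimes>\<^sub>M N) (\<lambda>\<omega>. (L \<omega>, V \<omega>))"
proof -
  note [measurable] = lin_measurable[OF L]
  have WJ: "W j \<in> borel_measurable M" if "j \<in> J" for j using that J by auto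
  note sub = subalgebra_generated_algebra[OF WJ]
  have VM [measurable]: "V \<in> M \<rightarrow>\<^sub>M N" by (rule measurable_from_subalg[OF sub V])
  have ev: "prob (L -` A \<inter> space M \<inter> (V -` B \<inter> space M)) = prob (L -` A \<inter> space M) * prob (V -` B \<inter> space M)"
    if [measurable]: "A \<in> sets borel" "B \<in> sets N" for A B
  proof -
    define S where "S = V -` B \<inter> space M"
    have S [measurable]: "S \<in> sets M" unfolding S_def by measurable
    have S': "S \<in> sets (generated_algebra M W J)"
      unfolding S_def using measurable_sets[OF V that(2)] by simp
    have "(\<integral>\<omega>. (indicator S \<omega> - prob S) * indicator A (L \<omega>) \<partial>M) = 0"
    proof (rule fourier_zero_imp_indicator_zero_real[of _ _ 1])
      show "\<bar>indicator S \<omega> - prob S\<bar> \<le> 1" for \<omega> by (auto simp: indicator_def)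
      fix u
      have uL: "(\<lambda>\<omega>. u * L \<omega>) \<in> lin_comb W T" by (rule lin_comb_scale[OF L])
      have i: "indicator S \<in> borel_measurable (generated_algebra M W J)" using S' by simp
      have "(\<integral>\<omega>. cis (u * L \<omega>) * indicator S \<omega> \<partial>M) = (\<integral>\<omega>. cis (u * L \<omega>) \<partial>M) * (\<integral>\<omega>. indicator S \<omega> \<partial>M)"
        by (rule orthogonal_char_factorises[OF uL J _ i, of 1]) (auto simp: inner_scale_left orth indicator_def)
      also have "(\<integral>\<omega>. indicator S \<omega> \<partial>M) = (\<integral>\<omega>. complex_of_real (indicat_real S \<omega>) \<partial>M)"
        by (intro Bochner_Integration.integral_cong) (auto simp: indicator_def)
      also have "\<dots> = complex_of_real (prob S)"
        unfolding integral_complex_of_real by simp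
      finally have *: "(\<integral>\<omega>. cis (u * L \<omega>) * indicator S \<omega> \<partial>M) = (\<integral>\<omega>. cis (u * L \<omega>) \<partial>M) * prob S" .
      have "integrable M (\<lambda>\<omega>. cis (u * L \<omega>) * indicator S \<omega>)"
        by (rule integrable_bounded[of _ 1])
          (use cis_lin_measurable[OF uL] in \<open>auto simp: indicator_def\<close>)
      then have "(\<integral>\<omega>. cis (u * L \<omega>) * indicator S \<omega> - cis (u * L \<omega>) * prob S \<partial>M) = 0"
        using integrable_cis_lin[OF uL] by (simp add: *)
      moreover have "(\<lambda>\<omega>. complex_of_real (indicator S \<omega> - prob S) * cis (u * L \<omega>))
          = (\<lambda>\<omega>. cis (u * L \<omega>) * indicator S \<omega> - cis (u * L \<omega>) * prob S)"
        by (auto simp: indicator_def algebra_simps)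
      ultimately show "(\<integral>\<omega>. complex_of_real (indicator S \<omega> - prob S) * cis (u * L \<omega>) \<partial>M) = 0"
        by (simp only:)
    qed auto
    moreover have "(indicator S \<omega> - prob S) * indicator A (L \<omega>)
        = indicator (L -` A \<inter> space M \<inter> S) \<omega> - prob S * indicator (L -` A \<inter> space M) \<omega>" if "\<omega> \<in> space M" for \<omega>
      using that by (auto simp: indicator_def)
    ultimately have "(\<integral>\<omega>. indicator (L -` A \<inter> space M \<inter> S) \<omega> - prob S * indicator (L -` A \<inter> space M) \<omega> \<partial>M) = 0"
      by (simp cong: Bochner_Integration.integral_cong)
    then show ?thesis
      by (subst (asm) Bochner_Integration.integral_diff)
         (auto simp: S_def[symmetric] emeasure_eq_measure mult.commute)
  qed
  interpret L: prob_space "distr M borel L" by (rule prob_space_distr) measurable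
  interpret V: prob_space "distr M N V" by (rule prob_space_distr) measurable
  show ?thesis
  proof (rule pair_measure_eqI)
    fix A B assume "A \<in> sets (distr M borel L)" "B \<in> sets (distr M N V)"
    then have AB [measurable]: "A \<in> sets borel" "B \<in> sets N" by auto
    have "(\<lambda>\<omega>. (L \<omega>, V \<omega>)) -` (A \<times> B) \<inter> space M = L -` A \<inter> space M \<inter> (V -` B \<inter> space M)"
      by auto
    then show "emeasure (distr M borel L) A * emeasure (distr M N V) B =
        emeasure (distr M (borel \<Otimes>\<^sub>M N) (\<lambda>\<omega>. (L \<omega>, V \<omega>))) (A \<times> B)"
      using ev[OF AB] by (simp add: emeasure_distr emeasure_eq_measure ennreal_mult)
  qed (auto intro: L.sigma_finite_measure_axioms V.sigma_finite_measure_axioms)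
qed

end

section \<open>The Slepian covariance and conditional independence of bridges\<close>

locale slepian =
  fixes q d :: real and M :: "'a measure" and W :: "real \<Rightarrow> 'a \<Rightarrow> real"
  assumes q_pos: "0 < q" and q_less_d: "q < d" and d_le: "d \<le> 2 * q"
    and slepian: "slepian_process q d M W"

sublocale slepian \<subseteq> centered_gaussian_process M "{q..d}" W
proof -
  interpret prob_space M using slepian by (simp add: slepian_process_def gaussian_process_def)
  show "centered_gaussian_process M {q..d} W"
    by unfold_locales (use slepian in \<open>auto simp: slepian_process_def\<close>)
qed

context slepian
begin

text \<open>No pair of times is more than \<open>q\<close> apart, so taking the positive part changes nothing.\<close>
lemma inner_W:
  assumes s: "s \<in> {q..d}" and r: "r \<in> {q..d}"
  shows "inner_E (W s) (W r) = 1 - \<bar>s - r\<bar> / q"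
proof -
  have *: "inner_E (W s) (W r) = 1 - (r - s) / q" if s: "s \<in> {q..d}" and r: "r \<in> {q..d}" and "s \<le> r" for s r
  proof -
    have "\<forall>s t. q \<le> s \<and> s \<le> s + t \<and> s + t \<le> d \<longrightarrow>
        covariance M (W s) (W (s + t)) = max 0 (1 - t / q)"
      using slepian unfolding slepian_process_def by (elim conjE)
    from this[rule_format, of s "r - s"] have "covariance M (W s) (W r) = max 0 (1 - (r - s) / q)"
      using s r \<open>s \<le> r\<close> by simp
    moreover have "(r - s) / q \<le> 1" using s r q_pos d_le by simp
    ultimately show ?thesis using s r by (simp add: covariance_def centered)
  qed
  show ?thesis
  proof (cases "s \<le> r")
    case True
    then show ?thesis using *[OF s r] by simp
  next
    case False
    then show ?thesis using *[OF r s] inner_commute[of "W s" "W r"] by simp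
  qed
qed

lemmas lin_W = lin_comb_base[of _ "{q..d}" W]

lemma lin_comb_minus2:
  assumes "s \<in> {q..d}" "a \<in> {q..d}" "b \<in> {q..d}"
  shows "(\<lambda>\<omega>. W s \<omega> - (\<alpha> * W a \<omega> + \<beta> * W b \<omega>)) \<in> lin_comb W {q..d}"
  using assms lin_W by (intro lin_comb_diff lin_comb_add[OF lin_comb_scale lin_comb_scale])

lemma inner_minus2:
  assumes "s \<in> {q..d}" "a \<in> {q..d}" "b \<in> {q..d}" "r \<in> {q..d}"
  shows "inner_E (\<lambda>\<omega>. W s \<omega> - (\<alpha> * W a \<omega> + \<beta> * W b \<omega>)) (W r)
    = (1 - \<bar>s - r\<bar> / q) - (\<alpha> * (1 - \<bar>a - r\<bar> / q) + \<beta> * (1 - \<bar>b - r\<bar> / q))"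
proof -
  have l: "W s \<in> lin_comb W {q..d}" "(\<lambda>\<omega>. \<alpha> * W a \<omega>) \<in> lin_comb W {q..d}"
    "(\<lambda>\<omega>. \<beta> * W b \<omega>) \<in> lin_comb W {q..d}" "W r \<in> lin_comb W {q..d}"
    using assms lin_W lin_comb_scale by blast+
  show ?thesis
    by (simp only: inner_diff_left[OF l(1) lin_comb_add[OF l(2,3)] l(4)] inner_add_left[OF l(2,3,4)]
      inner_scale_left inner_W assms)
qed

definition lin_interp :: "real \<Rightarrow> real \<Rightarrow> real \<Rightarrow> real \<Rightarrow> real \<Rightarrow> real" where
  "lin_interp a b s x y = ((b - s) / (b - a)) * x + ((s - a) / (b - a)) * y"

text \<open>
  As a function of its first argument on \<open>[a, b]\<close>, the covariance with \<open>W r\<close> is affine, so linear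
  interpolation reproduces it exactly.
\<close>
lemma bridge_orthogonal:
  assumes ab: "q \<le> a" "a < b" "b \<le> d" and s: "a \<le> s" "s \<le> b"
    and r: "r \<in> {q..d}" "r \<le> a \<or> b \<le> r"
  shows "inner_E (\<lambda>\<omega>. W s \<omega> - lin_interp a b s (W a \<omega>) (W b \<omega>)) (W r) = 0"
proof -
  have e: "inner_E (\<lambda>\<omega>. W s \<omega> - lin_interp a b s (W a \<omega>) (W b \<omega>)) (W r)
    = (1 - \<bar>s - r\<bar> / q) - ((b - s) / (b - a) * (1 - \<bar>a - r\<bar> / q) + (s - a) / (b - a) * (1 - \<bar>b - r\<bar> / q))"
    unfolding lin_interp_def by (rule inner_minus2) (use ab s r in auto)
  show ?thesis
  proof (cases "r \<le> a")
    case True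
    then have "\<bar>s - r\<bar> = s - r" "\<bar>a - r\<bar> = a - r" "\<bar>b - r\<bar> = b - r" using s ab by auto
    then show ?thesis unfolding e using q_pos ab by (simp add: divide_simps) (simp add: algebra_simps)
  next
    case False
    then have "\<bar>s - r\<bar> = r - s" "\<bar>a - r\<bar> = r - a" "\<bar>b - r\<bar> = r - b" using s ab r by auto
    then show ?thesis unfolding e using q_pos ab by (simp add: divide_simps) (simp add: algebra_simps)
  qed
qed

text \<open>By orthogonality only the covariance of the residual with \<open>W s\<close> itself survives.\<close>
lemma bridge_variance:
  assumes ab: "q \<le> a" "a < b" "b \<le> d" and s: "a \<le> s" "s \<le> b"
  shows "inner_E (\<lambda>\<omega>. W s \<omega> - lin_interp a b s (W a \<omega>) (W b \<omega>)) (\<lambda>\<omega>. W s \<omega> - lin_interp a b s (W a \<omega>) (W b \<omega>))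
    = 2 * (s - a) * (b - s) / (q * (b - a))" (is "inner_E ?R ?R = _")
proof -
  have ins: "s \<in> {q..d}" "a \<in> {q..d}" "b \<in> {q..d}" using ab s by auto
  have R: "?R \<in> lin_comb W {q..d}" unfolding lin_interp_def by (rule lin_comb_minus2[OF ins])
  let ?x = "\<lambda>\<omega>. (b - s) / (b - a) * W a \<omega>" and ?y = "\<lambda>\<omega>. (s - a) / (b - a) * W b \<omega>"
  have l: "W s \<in> lin_comb W {q..d}" "?x \<in> lin_comb W {q..d}" "?y \<in> lin_comb W {q..d}"
    using ins lin_W lin_comb_scale by blast+
  have "inner_E ?R ?R = inner_E (W s) ?R - (inner_E ?x ?R + inner_E ?y ?R)"
    using inner_diff_left[OF l(1) lin_comb_add[OF l(2,3)] R] inner_add_left[OF l(2,3) R]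
    by (simp only: lin_interp_def)
  also have "inner_E ?x ?R = 0"
    using bridge_orthogonal[OF ab s, of a] ins inner_commute[of "W a" ?R]
    by (simp only: inner_scale_left) simp
  also have "inner_E ?y ?R = 0"
    using bridge_orthogonal[OF ab s, of b] ins inner_commute[of "W b" ?R]
    by (simp only: inner_scale_left) simp
  also have "inner_E (W s) ?R = (1 - \<bar>s - s\<bar> / q) -
      ((b - s) / (b - a) * (1 - \<bar>a - s\<bar> / q) + (s - a) / (b - a) * (1 - \<bar>b - s\<bar> / q))"
    by (subst inner_commute, unfold lin_interp_def, rule inner_minus2) (use ins in auto)
  also have "\<bar>a - s\<bar> = s - a" using s by simp
  also have "\<bar>b - s\<bar> = b - s" using s by simp
  finally show ?thesis using q_pos ab by (simp add: divide_simps) (simp add: algebra_simps)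
qed

text \<open>
  The complementary statement: the projection of an outer value \<open>W r\<close> onto the two end values leaves a
  residual uncorrelated with the whole segment \<open>[a, b]\<close>. Both \<open>1 - (s - a) / q\<close> and
  \<open>1 - (b - s) / q\<close> are affine in \<open>s\<close>, with slopes \<open>-1 / q\<close> and \<open>1 / q\<close>. So comparing slopes fixes the
  difference of the two coefficients, and comparing values at one point fixes the coefficients,
  the sum of the two functions being the positive constant \<open>2 - (b - a) / q\<close>.
\<close>
lemma outer_projection:
  assumes ab: "q \<le> a" "a < b" "b \<le> d" and r: "r \<in> {q..d} - {a<..<b}"
  obtains \<alpha> \<beta> where "\<And>s. s \<in> {a..b} \<Longrightarrow>
    inner_E (\<lambda>\<omega>. W r \<omega> - (\<alpha> * W a \<omega> + \<beta> * W b \<omega>)) (W s) = 0"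
proof -
  have e: "2 * q - (b - a) > 0" using ab d_le q_pos by simp
  have ins: "r \<in> {q..d}" "a \<in> {q..d}" "b \<in> {q..d}" using ab r by auto
  consider "r \<le> a" | "b \<le> r" using r by force
  then show ?thesis
  proof cases
    case 1
    \<comment> \<open>equality of slopes forces the coefficients \<open>\<alpha>\<close> and \<open>\<alpha> - 1\<close>, and the value at \<open>s = a\<close> then gives \<open>\<alpha>\<close>\<close>
    define \<alpha> where "\<alpha> = 1 - (a - r) / (2 * q - (b - a))"
    have \<alpha>: "(\<alpha> - 1) * (2 * q - (b - a)) = r - a" using e by (simp add: \<alpha>_def)
    show ?thesis
    proof (rule that[of \<alpha> "\<alpha> - 1"])
      fix s assume s: "s \<in> {a..b}"
      have abs: "\<bar>r - s\<bar> = s - r" "\<bar>a - s\<bar> = s - a" "\<bar>b - s\<bar> = b - s" using s 1 by auto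
      have "q * ((1 - (s - r) / q) - (\<alpha> * (1 - (s - a) / q) + (\<alpha> - 1) * (1 - (b - s) / q)))
          = (r - a) - (\<alpha> - 1) * (2 * q - (b - a))"
        using q_pos by (simp add: field_simps)
      then show "inner_E (\<lambda>\<omega>. W r \<omega> - (\<alpha> * W a \<omega> + (\<alpha> - 1) * W b \<omega>)) (W s) = 0"
        using inner_minus2[OF ins, of s \<alpha> "\<alpha> - 1"] s ab q_pos \<alpha> unfolding abs by auto
    qed
  next
    case 2
    define \<beta> where "\<beta> = 1 - (r - b) / (2 * q - (b - a))"
    have \<beta>: "(\<beta> - 1) * (2 * q - (b - a)) = b - r" using e by (simp add: \<beta>_def)
    show ?thesis
    proof (rule that[of "\<beta> - 1" \<beta>])
      fix s assume s: "s \<in> {a..b}"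
      have abs: "\<bar>r - s\<bar> = r - s" "\<bar>a - s\<bar> = s - a" "\<bar>b - s\<bar> = b - s" using s 2 by auto
      have "q * ((1 - (r - s) / q) - ((\<beta> - 1) * (1 - (s - a) / q) + \<beta> * (1 - (b - s) / q)))
          = (b - r) - (\<beta> - 1) * (2 * q - (b - a))"
        using q_pos by (simp add: field_simps)
      then show "inner_E (\<lambda>\<omega>. W r \<omega> - ((\<beta> - 1) * W a \<omega> + \<beta> * W b \<omega>)) (W s) = 0"
        using inner_minus2[OF ins, of s "\<beta> - 1" \<beta>] s ab q_pos \<beta> unfolding abs by auto
    qed
  qed
qed

text \<open>
  It suffices to test with exponentials of combinations of outer values. Such a combination is a
  combination of \<open>W a\<close> and \<open>W b\<close> plus a residual \<open>N\<close> that is independent of the segment. The factor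
  \<open>cis N\<close> splits off, and what remains is the defining property of the conditional probability \<open>p\<close>.
\<close>
proposition markov_block:
  fixes p :: "real \<times> real \<Rightarrow> real" and Z :: "'a \<Rightarrow> real"
  assumes ab: "q \<le> a" "a < b" "b \<le> d"
    and E: "E \<in> sets (generated_algebra M W {a..b})"
    and p [measurable]: "p \<in> borel_measurable borel" and p01: "\<And>z. 0 \<le> p z" "\<And>z. p z \<le> 1"
    and cond: "\<And>h :: real \<times> real \<Rightarrow> real. h \<in> borel_measurable borel \<Longrightarrow> (\<And>z. \<bar>h z\<bar> \<le> 1) \<Longrightarrow>
        (\<integral>\<omega>. (indicator E \<omega> - p (W a \<omega>, W b \<omega>)) * h (W a \<omega>, W b \<omega>) \<partial>M) = 0"
    and Z: "Z \<in> borel_measurable (generated_algebra M W ({q..d} - {a<..<b}))"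
    and bdZ: "\<And>\<omega>. \<omega> \<in> space M \<Longrightarrow> \<bar>Z \<omega>\<bar> \<le> B"
  shows "(\<integral>\<omega>. (indicator E \<omega> - p (W a \<omega>, W b \<omega>)) * Z \<omega> \<partial>M) = 0"
proof -
  define Y where "Y \<omega> = indicator E \<omega> - p (W a \<omega>, W b \<omega>)" for \<omega>
  have ins: "a \<in> {q..d}" "b \<in> {q..d}" using ab by auto
  let ?N = "generated_algebra M W {a..b}"
  have Wab: "W s \<in> borel_measurable M" if "s \<in> {a..b}" for s using that ab by auto
  have [measurable]: "W a \<in> borel_measurable ?N" "W b \<in> borel_measurable ?N"
    using ab by (auto intro!: measurable_generated_algebra)
  have [measurable]: "E \<in> sets ?N" by fact
  have pair [measurable]: "(\<lambda>\<omega>. (W a \<omega>, W b \<omega>)) \<in> ?N \<rightarrow>\<^sub>M borel"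
    unfolding borel_prod[symmetric] by measurable
  have YN [measurable]: "Y \<in> borel_measurable ?N"
    unfolding Y_def[abs_def] by measurable
  have YM [measurable]: "Y \<in> borel_measurable M"
    by (rule measurable_from_subalg[OF subalgebra_generated_algebra[OF Wab] YN])
  have Y1: "\<bar>Y \<omega>\<bar> \<le> 1" for \<omega>
    using p01[of "(W a \<omega>, W b \<omega>)"] by (auto simp: Y_def indicator_def abs_le_iff)
  have condc: "(\<integral>\<omega>. complex_of_real (Y \<omega>) * cis (\<alpha> * W a \<omega> + \<beta> * W b \<omega>) \<partial>M) = 0" for \<alpha> \<beta>
  proof -
    let ?f = "\<lambda>\<omega>. cis (\<alpha> * W a \<omega> + \<beta> * W b \<omega>) * complex_of_real (Y \<omega>)"
    have fM: "(\<lambda>\<omega>. cis (\<alpha> * W a \<omega> + \<beta> * W b \<omega>)) \<in> borel_measurable M"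
      using ins by (intro cis_lin_measurable lin_comb_add[OF lin_comb_scale lin_comb_scale] lin_W)
    have int: "integrable M ?f"
      by (rule integrable_bounded[of _ 1]) (use fM Y1 in \<open>auto simp: norm_mult\<close>)
    have "(\<integral>\<omega>. Y \<omega> * (\<lambda>z. cos (\<alpha> * fst z + \<beta> * snd z)) (W a \<omega>, W b \<omega>) \<partial>M) = 0"
      unfolding Y_def by (rule cond) (auto intro!: borel_measurable_continuous_onI continuous_intros)
    moreover have "(\<integral>\<omega>. Y \<omega> * (\<lambda>z. sin (\<alpha> * fst z + \<beta> * snd z)) (W a \<omega>, W b \<omega>) \<partial>M) = 0"
      unfolding Y_def by (rule cond) (auto intro!: borel_measurable_continuous_onI continuous_intros)
    ultimately have "(\<integral>\<omega>. ?f \<omega> \<partial>M) = 0"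
      by (intro complex_eqI; unfold Re_Im_integral_mult_of_real[OF int]; simp add: mult.commute)
    then show ?thesis by (simp add: mult.commute)
  qed
  have "(\<integral>\<omega>. complex_of_real (Y \<omega>) * complex_of_real (Z \<omega>) \<partial>M) = 0"
  proof (rule fourier_zero_imp_orthogonal)
    show "(\<lambda>\<omega>. complex_of_real (Z \<omega>)) \<in> borel_measurable (generated_algebra M W ({q..d} - {a<..<b}))"
      using Z by measurable
    show "norm (complex_of_real (Y \<omega>)) \<le> 1" for \<omega> using Y1 by simp
    show "norm (complex_of_real (Z \<omega>)) \<le> B" if "\<omega> \<in> space M" for \<omega> using bdZ[OF that] by simp
    fix F u assume F: "finite F" "F \<subseteq> {q..d} - {a<..<b}"
    have "\<forall>r\<in>F. \<exists>c. \<forall>s\<in>{a..b}. inner_E (\<lambda>\<omega>. W r \<omega> - (fst c * W a \<omega> + snd c * W b \<omega>)) (W s) = 0"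
    proof
      fix r assume "r \<in> F"
      then have "r \<in> {q..d} - {a<..<b}" using F by auto
      from outer_projection[OF ab this] obtain \<alpha> \<beta> where
        "\<And>s. s \<in> {a..b} \<Longrightarrow> inner_E (\<lambda>\<omega>. W r \<omega> - (\<alpha> * W a \<omega> + \<beta> * W b \<omega>)) (W s) = 0"
        by blast
      then show "\<exists>c. \<forall>s\<in>{a..b}. inner_E (\<lambda>\<omega>. W r \<omega> - (fst c * W a \<omega> + snd c * W b \<omega>)) (W s) = 0"
        by (intro exI[of _ "(\<alpha>, \<beta>)"]) simp
    qed
    then obtain c where c: "\<And>r s. r \<in> F \<Longrightarrow> s \<in> {a..b} \<Longrightarrow>
        inner_E (\<lambda>\<omega>. W r \<omega> - (fst (c r) * W a \<omega> + snd (c r) * W b \<omega>)) (W s) = 0"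
      by metis
    define R where "R r \<omega> = W r \<omega> - (fst (c r) * W a \<omega> + snd (c r) * W b \<omega>)" for r \<omega>
    define N where "N \<omega> = (\<Sum>r\<in>F. u r * R r \<omega>)" for \<omega>
    define \<alpha> where "\<alpha> = (\<Sum>r\<in>F. u r * fst (c r))"
    define \<beta> where "\<beta> = (\<Sum>r\<in>F. u r * snd (c r))"
    have R: "R r \<in> lin_comb W {q..d}" if "r \<in> F" for r
      unfolding R_def[abs_def] using that F ins by (intro lin_comb_minus2) auto
    have NL: "N \<in> lin_comb W {q..d}" unfolding N_def[abs_def] by (rule lin_comb_sum[OF F(1) R])
    have dec: "(\<Sum>r\<in>F. u r * W r \<omega>) = N \<omega> + (\<alpha> * W a \<omega> + \<beta> * W b \<omega>)" for \<omega>
      unfolding N_def R_def \<alpha>_def \<beta>_def sum_distrib_right sum.distrib[symmetric]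
      by (intro sum.cong) (auto simp: algebra_simps)
    have orth: "inner_E N (W s) = 0" if s: "s \<in> {a..b}" for s
    proof -
      have "inner_E N (W s) = (\<Sum>r\<in>F. u r * inner_E (R r) (W s))"
        unfolding N_def using s ab by (intro inner_sum_left R lin_W) auto
      also have "\<dots> = 0" using c[OF _ s] by (intro sum.neutral) (auto simp: R_def)
      finally show ?thesis .
    qed
    let ?Z = "\<lambda>\<omega>. complex_of_real (Y \<omega>) * cis (\<alpha> * W a \<omega> + \<beta> * W b \<omega>)"
    have "(\<integral>\<omega>. cis (N \<omega>) * ?Z \<omega> \<partial>M) = (\<integral>\<omega>. cis (N \<omega>) \<partial>M) * (\<integral>\<omega>. ?Z \<omega> \<partial>M)"
    proof (rule orthogonal_char_factorises[OF NL])
      show "?Z \<in> borel_measurable ?N" by (simp add: cis_conv_exp)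
      show "norm (?Z \<omega>) \<le> 1" for \<omega> using Y1 by (simp add: norm_mult)
    qed (use ab orth in auto)
    also have "\<dots> = 0" by (simp add: condc)
    finally show "(\<integral>\<omega>. complex_of_real (Y \<omega>) * cis (\<Sum>j\<in>F. u j * W j \<omega>) \<partial>M) = 0"
      by (simp add: dec cis_mult[symmetric] mult_ac)
  qed (use ab in auto)
  then have "complex_of_real (\<integral>\<omega>. Y \<omega> * Z \<omega> \<partial>M) = 0"
    by (simp flip: integral_complex_of_real)
  then show ?thesis by (simp add: Y_def)
qed

end

section \<open>Sequentially conditioned normals and iterated integrals\<close>

text \<open>Positive variance rules out the degenerate case.\<close>
lemma (in centered_gaussian_process) distributed_lin:
  assumes L: "L \<in> lin_comb W T" and v: "inner_E L L = v" "v > 0"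
  shows "distributed M lborel L (normal_density 0 (sqrt v))"
proof -
  have E0: "(\<integral>\<omega>. L \<omega> \<partial>M) = 0" by (rule expectation_lin[OF L])
  note [measurable] = lin_measurable[OF L]
  consider (normal) \<mu> \<sigma> where "\<sigma> > 0" "distributed M lborel L (normal_density \<mu> \<sigma>)"
    | (const) \<mu> where "AE \<omega> in M. L \<omega> = \<mu>"
    using gaussian_lin[OF L] unfolding gaussian_rv_def by blast
  then show ?thesis
  proof cases
    case normal
    have \<mu>: "\<mu> = 0" using normal_distributed_expectation[OF normal] E0 by simp
    have "v = \<sigma>\<^sup>2"
      using normal_distributed_variance[OF normal] E0 v by (simp add: power2_eq_square)
    then show ?thesis using normal \<mu> by simp
  next
    case const
    have "(\<integral>\<omega>. L \<omega> \<partial>M) = (\<integral>\<omega>. \<mu> \<partial>M)" by (rule integral_cong_AE) (use const in auto)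
    then have mu: "\<mu> = 0" using E0 by (simp add: prob_space)
    have "AE \<omega> in M. L \<omega> * L \<omega> = 0" using const unfolding mu by eventually_elim simp
    then have "inner_E L L = (\<integral>\<omega>. 0 \<partial>M)" by (intro integral_cong_AE) auto
    then show ?thesis using v by simp
  qed
qed

lemma iterated_integral_snoc:
  "iterated_integral b (js @ [k]) F x =
     iterated_integral b js (\<lambda>x. LINT y:{..b k}|lborel. F (x(k := y))) x"
  by (induction js arbitrary: x) auto

lemma iterated_integral_mult:
  "iterated_integral b js (\<lambda>x. c * F x) x = c * iterated_integral b js F x"
  by (induction js arbitrary: x) (simp_all add: set_lebesgue_integral_def mult.left_commute)

abbreviation seq_space :: "(nat \<Rightarrow> real) measure" where
  "seq_space \<equiv> \<Pi>\<^sub>M i\<in>UNIV. borel"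

text \<open>
  The variables with index in \<open>S\<close> as one total sequence. The filler \<open>0\<close> is the initial value of the
  parameters of the iterated integral, so a partially integrated function may be evaluated at it.
\<close>
definition masked :: "(nat \<Rightarrow> 'a \<Rightarrow> real) \<Rightarrow> nat set \<Rightarrow> 'a \<Rightarrow> nat \<Rightarrow> real" where
  "masked X S \<omega> = (\<lambda>i. if i \<in> S then X i \<omega> else 0)"

lemma masked_measurable [measurable]:
  assumes "\<And>i. i \<in> S \<Longrightarrow> X i \<in> borel_measurable N"
  shows "masked X S \<in> N \<rightarrow>\<^sub>M seq_space"
  unfolding masked_def[abs_def]
proof (rule measurable_PiM_single')
  show "(\<lambda>\<omega>. if i \<in> S then X i \<omega> else 0) \<in> borel_measurable N" for i
    using assms by (cases "i \<in> S") auto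
qed (auto simp: space_PiM)

lemma update_measurable [measurable]:
  assumes f: "f \<in> N \<rightarrow>\<^sub>M seq_space" and h [measurable]: "h \<in> borel_measurable N"
  shows "(\<lambda>z. (f z)(k := h z)) \<in> N \<rightarrow>\<^sub>M seq_space"
proof (rule measurable_PiM_single')
  fix i
  have [measurable]: "(\<lambda>z. f z i) \<in> borel_measurable N"
    using measurable_compose[OF f measurable_component_singleton[of i UNIV]] by simp
  show "(\<lambda>z. ((f z)(k := h z)) i) \<in> borel_measurable N"
    by (cases "i = k") auto
qed (auto simp: space_PiM)

text \<open>
  Given \<open>V\<close>, the variable \<open>X = (X - m V) + m V\<close> is a centered normal shifted by a constant. Independence
  of the residual from \<open>V\<close> and Fubini's theorem make this precise.
\<close>
lemma (in prob_space) condition_on_normal_residual: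
  fixes V :: "'a \<Rightarrow> nat \<Rightarrow> real" and m :: "(nat \<Rightarrow> real) \<Rightarrow> real" and G :: "real \<Rightarrow> (nat \<Rightarrow> real) \<Rightarrow> real"
  assumes \<sigma>: "\<sigma> > 0" and [measurable]: "m \<in> borel_measurable seq_space"
    and D: "distributed M lborel (\<lambda>\<omega>. X \<omega> - m (V \<omega>)) (normal_density 0 \<sigma>)"
    and V [measurable]: "V \<in> M \<rightarrow>\<^sub>M seq_space"
    and prod: "distr M borel (\<lambda>\<omega>. X \<omega> - m (V \<omega>)) \<Otimes>\<^sub>M distr M seq_space V =
      distr M (borel \<Otimes>\<^sub>M seq_space) (\<lambda>\<omega>. (X \<omega> - m (V \<omega>), V \<omega>))"
    and G [measurable]: "(\<lambda>(y, v). G y v) \<in> borel_measurable (borel \<Otimes>\<^sub>M seq_space)"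
    and bd: "\<And>y v. \<bar>G y v\<bar> \<le> B"
  shows "(\<integral>\<omega>. G (X \<omega>) (V \<omega>) \<partial>M) =
    (\<integral>\<omega>. (\<integral>y. normal_density (m (V \<omega>)) \<sigma> y * G y (V \<omega>) \<partial>lborel) \<partial>M)"
proof -
  let ?R = "\<lambda>\<omega>. X \<omega> - m (V \<omega>)"
  have R [measurable]: "?R \<in> borel_measurable M" using distributed_measurable[OF D] by simp
  let ?\<Phi> = "\<lambda>r v. G (r + m v) v"
  have \<Phi> [measurable]: "(\<lambda>(r, v). ?\<Phi> r v) \<in> borel_measurable (borel \<Otimes>\<^sub>M seq_space)"
  proof -
    have "(\<lambda>z. (\<lambda>(y, v). G y v) (fst z + m (snd z), snd z)) \<in> borel_measurable (borel \<Otimes>\<^sub>M seq_space)"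
      by (rule measurable_compose[OF _ G]) measurable
    then show ?thesis by (simp add: case_prod_beta')
  qed
  interpret R: prob_space "distr M borel ?R" by (rule prob_space_distr) measurable
  interpret V: prob_space "distr M seq_space V" by (rule prob_space_distr) measurable
  interpret RV: pair_prob_space "distr M borel ?R" "distr M seq_space V" ..
  have dR: "distr M borel ?R = density lborel (normal_density 0 \<sigma>)"
    using distributed_distr_eq_density[OF D] by (simp cong: distr_cong)
  have shift: "(\<integral>r. ?\<Phi> r v \<partial>distr M borel ?R) = (\<integral>y. normal_density (m v) \<sigma> y * G y v \<partial>lborel)" for v
  proof -
    have [measurable]: "(\<lambda>y. G y v) \<in> borel_measurable borel"
      using measurable_compose[OF _ G, of "\<lambda>y. (y, v)" borel] by (simp add: space_PiM)
    have "(\<integral>r. ?\<Phi> r v \<partial>distr M borel ?R) = (\<integral>r. normal_density 0 \<sigma> r * G (r + m v) v \<partial>lborel)"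
      unfolding dR by (subst integral_density) auto
    also have "\<dots> = (\<integral>y. normal_density 0 \<sigma> (- m v + 1 * y) * G ((- m v + 1 * y) + m v) v \<partial>lborel)"
      by (subst lborel_integral_real_affine[where c = 1 and t = "- m v"]) auto
    also have "\<dots> = (\<integral>y. normal_density (m v) \<sigma> y * G y v \<partial>lborel)"
      by (simp add: normal_density_def)
    finally show ?thesis .
  qed
  have "(\<integral>\<omega>. G (X \<omega>) (V \<omega>) \<partial>M) = (\<integral>\<omega>. (\<lambda>(r, v). ?\<Phi> r v) (?R \<omega>, V \<omega>) \<partial>M)"
    by simp
  also have "\<dots> = (\<integral>z. (\<lambda>(r, v). ?\<Phi> r v) z \<partial>distr M (borel \<Otimes>\<^sub>M seq_space) (\<lambda>\<omega>. (?R \<omega>, V \<omega>)))"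
    by (rule integral_distr[symmetric]) measurable
  also have "\<dots> = (\<integral>v. (\<integral>r. ?\<Phi> r v \<partial>distr M borel ?R) \<partial>distr M seq_space V)"
    unfolding prod[symmetric]
  proof (rule RV.integral_snd[symmetric])
    show "integrable (distr M borel ?R \<Otimes>\<^sub>M distr M seq_space V) (\<lambda>(x, y). G (x + m y) y)"
      by (rule RV.P.integrable_const_bound[of _ B]) (use bd in \<open>auto cong: measurable_cong_sets\<close>)
  qed
  also have "\<dots> = (\<integral>\<omega>. (\<integral>r. ?\<Phi> r (V \<omega>) \<partial>distr M borel ?R) \<partial>M)"
  proof (rule integral_distr)
    show "(\<lambda>v. \<integral>r. ?\<Phi> r v \<partial>distr M borel ?R) \<in> borel_measurable seq_space"
      by (rule R.borel_measurable_lebesgue_integral) 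
        (use measurable_compose[OF measurable_pair_swap' \<Phi>] in \<open>simp add: case_prod_beta' cong: measurable_cong_sets\<close>)
  qed measurable
  also have "\<dots> = (\<integral>\<omega>. (\<integral>y. normal_density (m (V \<omega>)) \<sigma> y * G y (V \<omega>) \<partial>lborel) \<partial>M)"
    by (simp only: shift)
  finally show ?thesis .
qed

text \<open>
  The last variable of the list is the innermost of the iterated integral. Integrating it out
  against its conditional density turns \<open>H\<close> into a function of the earlier variables, with the same bound,
  so induction from the end of the list applies.
\<close>
proposition (in prob_space) sequential_density:
  fixes X :: "nat \<Rightarrow> 'a \<Rightarrow> real"
  assumes "distinct js"
    and "\<And>j. j \<in> set js \<Longrightarrow> X j \<in> borel_measurable M"
    and "\<And>as k bs. js = as @ k # bs \<Longrightarrow> \<sigma> k > 0"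
    and "\<And>as k bs. js = as @ k # bs \<Longrightarrow> m k \<in> borel_measurable seq_space"
    and "\<And>as k bs. js = as @ k # bs \<Longrightarrow>
      distributed M lborel (\<lambda>\<omega>. X k \<omega> - m k (masked X (set as) \<omega>)) (normal_density 0 (\<sigma> k))"
    and "\<And>as k bs. js = as @ k # bs \<Longrightarrow>
      distr M borel (\<lambda>\<omega>. X k \<omega> - m k (masked X (set as) \<omega>)) \<Otimes>\<^sub>M distr M seq_space (masked X (set as)) =
      distr M (borel \<Otimes>\<^sub>M seq_space) (\<lambda>\<omega>. (X k \<omega> - m k (masked X (set as) \<omega>), masked X (set as) \<omega>))"
    and "\<And>as k bs j x y. js = as @ k # bs \<Longrightarrow> j \<notin> set as \<Longrightarrow> m k (x(j := y)) = m k x"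
    and "H \<in> borel_measurable seq_space" and "\<And>x. \<bar>H x\<bar> \<le> B"
  shows "(\<integral>\<omega>. (\<Prod>j\<in>set js. indicator {..b j} (X j \<omega>)) * H (masked X (set js) \<omega>) \<partial>M) =
    iterated_integral b js (\<lambda>x. (\<Prod>j\<in>set js. normal_density (m j x) (\<sigma> j) (x j)) * H x) (\<lambda>_. 0)"
  using assms
proof (induction js arbitrary: H rule: rev_induct)
  case Nil
  then show ?case by (simp add: masked_def prob_space)
next
  case (snoc k js)
  note X = snoc.prems(2)
  have split: "js @ [k] = as @ j # (bs @ [k])" if "js = as @ j # bs" for as j bs using that by simp
  have last: "js @ [k] = js @ k # []" by simp
  have k: "k \<notin> set js" and dist: "distinct js" using snoc.prems(1) by auto
  have \<sigma>: "\<sigma> k > 0" by (rule snoc.prems(3)[OF last])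
  have m [measurable]: "m k \<in> borel_measurable seq_space" by (rule snoc.prems(4)[OF last])
  have H [measurable]: "H \<in> borel_measurable seq_space" and bd: "\<And>x. \<bar>H x\<bar> \<le> B"
    by fact+
  have B0: "B \<ge> 0" using bd[of undefined] by linarith
  define H' where "H' x = (\<integral>y. normal_density (m k x) (\<sigma> k) y * (indicator {..b k} y * H (x(k := y))) \<partial>lborel)" for x
  have nd [measurable]: "(\<lambda>z. normal_density (m k (fst z)) (\<sigma> k) (snd z)) \<in> borel_measurable (seq_space \<Otimes>\<^sub>M borel)"
    unfolding normal_density_def by measurable
  have [measurable]: "(\<lambda>z. H ((fst z)(k := snd z))) \<in> borel_measurable (seq_space \<Otimes>\<^sub>M borel)"
    by (rule measurable_compose[OF _ H]) measurable
  have H'm [measurable]: "H' \<in> borel_measurable seq_space"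
    unfolding H'_def[abs_def]
    by (rule lborel.borel_measurable_lebesgue_integral) (simp add: case_prod_beta' cong: measurable_cong_sets)
  have H'bd: "\<bar>H' x\<bar> \<le> B" for x
  proof -
    have le: "norm (indicator {..b k} y * H (x(k := y))) \<le> B" for y
      using bd[of "x(k := y)"] B0 by (auto simp: indicator_def)
    have "norm (H' x) \<le> (\<integral>y. normal_density (m k x) (\<sigma> k) y * B \<partial>lborel)"
      unfolding H'_def
    proof (rule Bochner_Integration.integral_norm_bound_integral)
      have [measurable]: "(\<lambda>y. H (x(k := y))) \<in> borel_measurable borel"
        by (rule measurable_compose[OF _ H]) (measurable, auto simp: space_PiM)
      show *: "integrable lborel (\<lambda>y. normal_density (m k x) (\<sigma> k) y * B)" using \<sigma> by simp
      show "norm (normal_density (m k x) (\<sigma> k) y * (indicator {..b k} y * H (x(k := y)))) \<le> normal_density (m k x) (\<sigma> k) y * B" for y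
        using mult_left_mono[OF le normal_density_nonneg] by (simp add: abs_mult)
      then show "integrable lborel (\<lambda>y. normal_density (m k x) (\<sigma> k) y * (indicator {..b k} y * H (x(k := y))))"
        by (intro Bochner_Integration.integrable_bound[OF *]) (auto intro!: AE_I2 simp: B0 abs_mult)
    qed
    also have "\<dots> = B" using \<sigma> by simp
    finally show ?thesis by simp
  qed
  let ?V = "masked X (set js)"
  let ?I = "\<lambda>v. \<Prod>j\<in>set js. indicator {..b j} (v j) :: real"
  let ?G = "\<lambda>y v. ?I v * (indicator {..b k} y * H (v(k := y)))"
  have I01: "\<bar>?I v\<bar> \<le> 1" for v by (auto simp: abs_prod intro!: prod_le_1)
  have Vj: "masked X (set js) \<omega> j = X j \<omega>" if "j \<in> set js" for j \<omega> using that by (simp add: masked_def)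
  have upd: "(masked X (set js) \<omega>)(k := X k \<omega>) = masked X (set (js @ [k])) \<omega>" for \<omega>
    by (auto simp: masked_def)
  have "(\<integral>\<omega>. (\<Prod>j\<in>set (js @ [k]). indicator {..b j} (X j \<omega>)) * H (masked X (set (js @ [k])) \<omega>) \<partial>M)
      = (\<integral>\<omega>. ?G (X k \<omega>) (?V \<omega>) \<partial>M)"
    using k by (intro Bochner_Integration.integral_cong) (simp_all add: upd Vj mult_ac)
  also have "\<dots> = (\<integral>\<omega>. (\<integral>y. normal_density (m k (?V \<omega>)) (\<sigma> k) y * ?G y (?V \<omega>) \<partial>lborel) \<partial>M)"
  proof (rule condition_on_normal_residual[OF \<sigma> m snoc.prems(5)[OF last] _ snoc.prems(6)[OF last]])
    show "masked X (set js) \<in> M \<rightarrow>\<^sub>M seq_space" using X by (intro masked_measurable) auto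
    have [measurable]: "(\<lambda>z. H ((snd z)(k := fst z))) \<in> borel_measurable (borel \<Otimes>\<^sub>M seq_space)"
      by (rule measurable_compose[OF _ H]) measurable
    show "(\<lambda>(y, v). ?G y v) \<in> borel_measurable (borel \<Otimes>\<^sub>M seq_space)"
      by (simp add: case_prod_beta')
    show "\<bar>?G y v\<bar> \<le> B" for y v
    proof -
      have "\<bar>?G y v\<bar> = \<bar>?I v\<bar> * (indicator {..b k} y * \<bar>H (v(k := y))\<bar>)" by (simp add: abs_mult)
      also have "\<dots> \<le> 1 * B"
        using bd[of "v(k := y)"] B0 by (intro mult_mono I01) (auto simp: indicator_def)
      finally show ?thesis by simp
    qed
  qed
  also have "\<dots> = (\<integral>\<omega>. (\<Prod>j\<in>set js. indicator {..b j} (X j \<omega>)) * H' (?V \<omega>) \<partial>M)"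
  proof (intro Bochner_Integration.integral_cong refl)
    fix \<omega>
    have "(\<integral>y. normal_density (m k (?V \<omega>)) (\<sigma> k) y * ?G y (?V \<omega>) \<partial>lborel) =
      (\<integral>y. ?I (?V \<omega>) * (normal_density (m k (?V \<omega>)) (\<sigma> k) y * (indicator {..b k} y * H ((?V \<omega>)(k := y)))) \<partial>lborel)"
      by (simp add: mult.left_commute)
    also have "\<dots> = ?I (?V \<omega>) * H' (?V \<omega>)"
      unfolding H'_def by (rule integral_mult_right_zero)
    finally have "(\<integral>y. normal_density (m k (?V \<omega>)) (\<sigma> k) y * ?G y (?V \<omega>) \<partial>lborel) = ?I (?V \<omega>) * H' (?V \<omega>)" .
    moreover have "?I (?V \<omega>) = (\<Prod>j\<in>set js. indicator {..b j} (X j \<omega>))"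
      by (intro prod.cong) (auto simp: Vj)
    ultimately show "(\<integral>y. normal_density (m k (?V \<omega>)) (\<sigma> k) y * ?G y (?V \<omega>) \<partial>lborel) = (\<Prod>j\<in>set js. indicator {..b j} (X j \<omega>)) * H' (?V \<omega>)"
      by (simp only:)
  qed
  also have "\<dots> = iterated_integral b js (\<lambda>x. (\<Prod>j\<in>set js. normal_density (m j x) (\<sigma> j) (x j)) * H' x) (\<lambda>_. 0)"
  proof (rule snoc.IH)
    fix as j bs assume "js = as @ j # bs"
    note s = split[OF this]
    show "\<sigma> j > 0" by (rule snoc.prems(3)[OF s])
    show "m j \<in> borel_measurable seq_space" by (rule snoc.prems(4)[OF s])
    show "distributed M lborel (\<lambda>\<omega>. X j \<omega> - m j (masked X (set as) \<omega>)) (normal_density 0 (\<sigma> j))"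
      by (rule snoc.prems(5)[OF s])
    show "distr M borel (\<lambda>\<omega>. X j \<omega> - m j (masked X (set as) \<omega>)) \<Otimes>\<^sub>M distr M seq_space (masked X (set as)) =
      distr M (borel \<Otimes>\<^sub>M seq_space) (\<lambda>\<omega>. (X j \<omega> - m j (masked X (set as) \<omega>), masked X (set as) \<omega>))"
      by (rule snoc.prems(6)[OF s])
    show "m j (x(i := y)) = m j x" if "i \<notin> set as" for i x y by (rule snoc.prems(7)[OF s that])
  qed (use dist X H'm H'bd in auto)
  also have "\<dots> = iterated_integral b (js @ [k]) (\<lambda>x. (\<Prod>j\<in>set (js @ [k]). normal_density (m j x) (\<sigma> j) (x j)) * H x) (\<lambda>_. 0)"
  proof -
    have mk: "m j (x(k := y)) = m j x" if "j \<in> set js" for j x y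
    proof -
      obtain as bs where s: "js = as @ j # bs" using \<open>j \<in> set js\<close> by (auto simp: in_set_conv_decomp)
      then have "k \<notin> set as" using k by auto
      then show ?thesis by (rule snoc.prems(7)[OF split[OF s]])
    qed
    have mkk: "m k (x(k := y)) = m k x" for x y by (rule snoc.prems(7)[OF last k])
    have "(\<Prod>j\<in>set js. normal_density (m j x) (\<sigma> j) (x j)) * H' x =
      (LINT y:{..b k}|lborel. (\<Prod>j\<in>set (js @ [k]). normal_density (m j (x(k := y))) (\<sigma> j) ((x(k := y)) j)) * H (x(k := y)))" for x
    proof -
      have p: "(\<Prod>j\<in>set (js @ [k]). normal_density (m j (x(k := y))) (\<sigma> j) ((x(k := y)) j))
          = normal_density (m k x) (\<sigma> k) y * (\<Prod>j\<in>set js. normal_density (m j x) (\<sigma> j) (x j))" for y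
        using k by (auto simp: mkk mk intro!: prod.cong)
      show ?thesis
        unfolding p H'_def set_lebesgue_integral_def integral_mult_right_zero[symmetric]
        by (intro Bochner_Integration.integral_cong) (auto simp: indicator_def)
    qed
    then show ?thesis by (simp only: iterated_integral_snoc)
  qed
  finally show ?case .
qed

section \<open>Staying below a boundary\<close>

text \<open>
  The boundary \<open>g\<close> may be irregular, so a dense set of times would not do. Instead, choose times over
  which the graph of \<open>g\<close> is dense in the whole graph: every point of the graph is then a limit of
  points at which the constraint holds, and the continuous \<open>f\<close> inherits it.
\<close>
lemma countable_constraint_reduction:
  fixes g :: "real \<Rightarrow> real" and I :: "real set"
  obtains D where "countable D" "D \<subseteq> I"
    "\<And>f. continuous_on I f \<Longrightarrow> (\<forall>s\<in>D. f s \<le> g s) \<Longrightarrow> (\<forall>s\<in>I. f s \<le> g s)"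
proof -
  obtain G where G: "countable G" "G \<subseteq> (\<lambda>s. (s, g s)) ` I" "(\<lambda>s. (s, g s)) ` I \<subseteq> closure G"
    by (rule separable)
  show ?thesis
  proof (rule that[of "fst ` G"])
    show "countable (fst ` G)" "fst ` G \<subseteq> I" using G by auto
    fix f :: "real \<Rightarrow> real" assume f: "continuous_on I f" and le: "\<forall>s\<in>fst ` G. f s \<le> g s"
    show "\<forall>s\<in>I. f s \<le> g s"
    proof
      fix s assume s: "s \<in> I"
      then have "(s, g s) \<in> closure G" using G by auto
      then obtain z where z: "\<And>k. z k \<in> G" "z \<longlonglongrightarrow> (s, g s)"
        unfolding closure_sequential by blast
      have zI: "fst (z k) \<in> I" "snd (z k) = g (fst (z k))" for k using z(1)[of k] G(2) by auto
      have "(\<lambda>k. fst (z k)) \<longlonglongrightarrow> s" "(\<lambda>k. snd (z k)) \<longlonglongrightarrow> g s"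
        using tendsto_fst[OF z(2)] tendsto_snd[OF z(2)] by simp_all
      moreover have "(\<lambda>k. f (fst (z k))) \<longlonglongrightarrow> f s"
        by (rule continuous_on_tendsto_compose[OF f]) (use calculation s zI in auto)
      moreover have "f (fst (z k)) \<le> snd (z k)" for k using le z(1)[of k] zI(2)[of k] by auto
      ultimately show "f s \<le> g s" by (intro LIMSEQ_le) auto
    qed
  qed
qed

lemma path_space_eval_measurable: "s \<in> {q..d} \<Longrightarrow> (\<lambda>f. f s) \<in> borel_measurable (path_space q d)"
  unfolding path_space_def by (intro measurable_restrict_space1 measurable_component_singleton)

lemma path_constraint_sets:
  assumes "I \<subseteq> {q..d}"
  shows "{f \<in> space (path_space q d). \<forall>s\<in>I. f s \<le> g s} \<in> sets (path_space q d)"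
proof -
  obtain D where D: "countable D" "D \<subseteq> I"
    "\<And>f. continuous_on I f \<Longrightarrow> (\<forall>s\<in>D. f s \<le> g s) \<Longrightarrow> (\<forall>s\<in>I. f s \<le> g s)"
    using countable_constraint_reduction[of I g] by blast
  have "continuous_on I f" if "f \<in> space (path_space q d)" for f
    using that assms by (auto simp: path_space_def space_restrict_space intro: continuous_on_subset)
  then have "{f \<in> space (path_space q d). \<forall>s\<in>I. f s \<le> g s} = {f \<in> space (path_space q d). \<forall>s\<in>D. f s \<le> g s}"
    using D by blast
  also have "\<dots> \<in> sets (path_space q d)"
  proof (rule sets.sets_Collect_countable_All'[OF _ D(1)])
    fix s assume "s \<in> D"
    then have [measurable]: "(\<lambda>f. f s) \<in> borel_measurable (path_space q d)"
      using D assms by (intro path_space_eval_measurable) auto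
    show "{f \<in> space (path_space q d). f s \<le> g s} \<in> sets (path_space q d)" by measurable
  qed
  finally show ?thesis .
qed

context slepian
begin

lemma W_continuous: "\<omega> \<in> space M \<Longrightarrow> continuous_on {q..d} (\<lambda>s. W s \<omega>)"
  using slepian by (simp add: slepian_process_def)

definition stays_below :: "(real \<Rightarrow> real) \<Rightarrow> real set \<Rightarrow> 'a set" where
  "stays_below g I = {\<omega> \<in> space M. \<forall>s\<in>I. W s \<omega> \<le> g s}"

lemma stays_below_sets_generated:
  assumes "I \<subseteq> J" "J \<subseteq> {q..d}"
  shows "stays_below g I \<in> sets (generated_algebra M W J)"
proof -
  obtain D where D: "countable D" "D \<subseteq> I"
    "\<And>f. continuous_on I f \<Longrightarrow> (\<forall>s\<in>D. f s \<le> g s) \<Longrightarrow> (\<forall>s\<in>I. f s \<le> g s)"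
    using countable_constraint_reduction[of I g] by blast
  have "continuous_on I (\<lambda>s. W s \<omega>)" if "\<omega> \<in> space M" for \<omega>
    using W_continuous[OF that] assms by (blast intro: continuous_on_subset)
  then have "stays_below g I = {\<omega> \<in> space M. \<forall>s\<in>D. W s \<omega> \<le> g s}"
    unfolding stays_below_def using D(2) D(3)[of "\<lambda>s. W s _"] by blast
  also have "\<dots> = {\<omega> \<in> space (generated_algebra M W J). \<forall>s\<in>D. W s \<omega> \<le> g s}" by simp
  also have "\<dots> \<in> sets (generated_algebra M W J)"
  proof (rule sets.sets_Collect_countable_All'[OF _ D(1)])
    fix s assume "s \<in> D"
    then have [measurable]: "W s \<in> borel_measurable (generated_algebra M W J)"
      using D assms by (intro measurable_generated_algebra) auto
    show "{\<omega> \<in> space (generated_algebra M W J). W s \<omega> \<le> g s} \<in> sets (generated_algebra M W J)" by measurable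
  qed
  finally show ?thesis .
qed

lemma stays_below_sets:
  assumes "I \<subseteq> {q..d}"
  shows "stays_below g I \<in> sets M"
  using stays_below_sets_generated[OF assms order_refl, of g] sets_generated_algebra_le[of "{q..d}" W M] by auto

lemma path_of_in_space: "\<omega> \<in> space M \<Longrightarrow> path_of q d W \<omega> \<in> space (path_space q d)"
  using continuous_on_eq[OF W_continuous, of \<omega> "path_of q d W \<omega>"]
  by (auto simp: path_space_def path_of_def space_restrict_space space_PiM)

lemma path_of_constraint:
  assumes "I \<subseteq> {q..d}"
  shows "{\<omega> \<in> space M. path_of q d W \<omega> \<in> {f \<in> space (path_space q d). \<forall>s\<in>I. f s \<le> g s}} = stays_below g I"
  using assms path_of_in_space by (auto simp: stays_below_def path_of_def subset_eq)

text \<open>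
  Any regular conditional law given the end values satisfies the only property of conditional
  probabilities that \<open>markov_block\<close> asks for.
\<close>
lemma conditional_law_integral:
  fixes h :: "real \<times> real \<Rightarrow> real"
  assumes law: "gaussian_conditional_law q d M W a b K" and ab: "a \<in> {q..d}" "b \<in> {q..d}"
    and I: "I \<subseteq> {q..d}" and S: "S = {f \<in> space (path_space q d). \<forall>s\<in>I. f s \<le> g s}"
    and h [measurable]: "h \<in> borel_measurable borel" and h1: "\<And>z. \<bar>h z\<bar> \<le> 1"
  shows "(\<integral>\<omega>. (indicator (stays_below g I) \<omega> - measure (K (W a \<omega>, W b \<omega>)) S) * h (W a \<omega>, W b \<omega>) \<partial>M) = 0"
proof -
  let ?pr = "\<lambda>\<omega>. (W a \<omega>, W b \<omega>)"
  let ?F = "vimage_algebra (space M) ?pr borel"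
  let ?E = "stays_below g I"
  have Ss: "S \<in> sets (path_space q d)" unfolding S by (rule path_constraint_sets[OF I])
  have K: "K \<in> borel \<rightarrow>\<^sub>M prob_algebra (path_space q d)"
    using law by (simp add: gaussian_conditional_law_def)
  have p [measurable]: "(\<lambda>z. measure (K z) S) \<in> borel_measurable borel"
    by (rule measurable_compose[OF measurable_prob_algebraD[OF K] measurable_measure_subprob_algebra[OF Ss]])
  have p01: "0 \<le> measure (K z) S" "measure (K z) S \<le> 1" for z
  proof -
    have "prob_space (K z)" using measurable_space[OF K, of z] by (simp add: space_prob_algebra)
    then show "0 \<le> measure (K z) S" "measure (K z) S \<le> 1" by (auto simp: prob_space.prob_le_1)
  qed
  have [measurable]: "W a \<in> borel_measurable M" "W b \<in> borel_measurable M" using ab by auto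
  have pr [measurable]: "?pr \<in> M \<rightarrow>\<^sub>M borel" unfolding borel_prod[symmetric] by measurable
  have sub: "subalgebra M ?F"
    unfolding subalgebra_def using sets_image_in_sets[OF refl pr] by auto
  interpret finite_measure_subalgebra M ?F by unfold_locales (rule sub)
  have [measurable]: "?E \<in> sets M" by (rule stays_below_sets[OF I])
  have "AE \<omega> in M. measure (K (?pr \<omega>)) S = real_cond_exp M ?F (indicator {\<omega> \<in> space M. path_of q d W \<omega> \<in> S}) \<omega>"
    using law Ss by (simp add: gaussian_conditional_law_def)
  then have AE: "AE \<omega> in M. real_cond_exp M ?F (indicator ?E) \<omega> = measure (K (?pr \<omega>)) S"
    unfolding S path_of_constraint[OF I] by eventually_elim simp
  have hF: "(\<lambda>\<omega>. h (?pr \<omega>)) \<in> borel_measurable ?F"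
    by (rule measurable_compose[OF measurable_vimage_algebra1 h]) auto
  have i1: "integrable M (\<lambda>\<omega>. h (?pr \<omega>) * indicator ?E \<omega>)"
    by (rule integrable_bounded[of _ 1]) (use h1 in \<open>auto simp: indicator_def\<close>)
  have "(\<integral>\<omega>. h (?pr \<omega>) * measure (K (?pr \<omega>)) S \<partial>M) = (\<integral>\<omega>. h (?pr \<omega>) * real_cond_exp M ?F (indicator ?E) \<omega> \<partial>M)"
  proof (rule integral_cong_AE)
    show "AE \<omega> in M. h (?pr \<omega>) * measure (K (?pr \<omega>)) S = h (?pr \<omega>) * real_cond_exp M ?F (indicator ?E) \<omega>"
      using AE by eventually_elim simp
  qed measurable
  also have "\<dots> = (\<integral>\<omega>. h (?pr \<omega>) * indicator ?E \<omega> \<partial>M)"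
    by (rule real_cond_exp_intg(2)[OF i1 hF]) measurable
  finally have eq: "(\<integral>\<omega>. h (?pr \<omega>) * measure (K (?pr \<omega>)) S \<partial>M) = (\<integral>\<omega>. h (?pr \<omega>) * indicator ?E \<omega> \<partial>M)" .
  have i2: "integrable M (\<lambda>\<omega>. h (?pr \<omega>) * measure (K (?pr \<omega>)) S)"
  proof (rule integrable_bounded[of _ 1])
    show "norm (h (?pr \<omega>) * measure (K (?pr \<omega>)) S) \<le> 1" for \<omega>
      using mult_mono[OF h1[of "?pr \<omega>"] p01(2)[of "?pr \<omega>"]] p01 by (simp add: abs_mult)
  qed measurable
  have "(\<integral>\<omega>. (indicator ?E \<omega> - measure (K (?pr \<omega>)) S) * h (?pr \<omega>) \<partial>M)
      = (\<integral>\<omega>. h (?pr \<omega>) * indicator ?E \<omega> - h (?pr \<omega>) * measure (K (?pr \<omega>)) S \<partial>M)"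
    by (simp add: algebra_simps)
  then show ?thesis using i1 i2 eq by simp
qed

end

text \<open>
  Here \<open>p i\<close> is any version of the conditional probability of staying below \<open>g\<close> on the open
  interval between two neighbouring grid points, given the values at these points.
\<close>
locale slepian_grid = slepian +
  fixes n :: nat and t :: "nat \<Rightarrow> real" and g :: "real \<Rightarrow> real"
    and p :: "nat \<Rightarrow> real \<times> real \<Rightarrow> real"
  assumes n: "n \<ge> 1" and t0: "t 0 = q" and tn: "t n = d"
    and t_step: "\<And>i. i < n \<Longrightarrow> t i < t (i + 1)"
    and p_measurable: "\<And>i. i < n \<Longrightarrow> p i \<in> borel_measurable borel"
    and p_nonneg: "\<And>i z. i < n \<Longrightarrow> 0 \<le> p i z" and p_le_1: "\<And>i z. i < n \<Longrightarrow> p i z \<le> 1"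
    and p_cond: "\<And>i h. i < n \<Longrightarrow> h \<in> borel_measurable borel \<Longrightarrow> (\<And>z. \<bar>h z :: real\<bar> \<le> 1) \<Longrightarrow>
      (\<integral>\<omega>. (indicator (stays_below g {t i<..<t (i + 1)}) \<omega> - p i (W (t i) \<omega>, W (t (i + 1)) \<omega>))
        * h (W (t i) \<omega>, W (t (i + 1)) \<omega>) \<partial>M) = 0"
begin

lemma t_less: "i < j \<Longrightarrow> j \<le> n \<Longrightarrow> t i < t j"
proof (induction j)
  case (Suc j)
  then show ?case using t_step[of j] by (cases "i = j") auto
qed simp

lemma t_mono: "i \<le> j \<Longrightarrow> j \<le> n \<Longrightarrow> t i \<le> t j"
  using t_less[of i j] by (cases "i = j") auto

lemma t_range: "i \<le> n \<Longrightarrow> t i \<in> {q..d}"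
  using t_mono[of 0 i] t_mono[of i n] t0 tn by auto

lemma Wt_measurable [measurable]: "i \<le> n \<Longrightarrow> W (t i) \<in> borel_measurable M"
  using t_range by auto

lemma grid_covers:
  assumes s: "s \<in> {q..d}"
  shows "(\<exists>j\<le>n. s = t j) \<or> (\<exists>i<n. s \<in> {t i<..<t (i + 1)})"
proof -
  \<comment> \<open>the first grid point that is not before \<open>s\<close>\<close>
  define k where "k = (LEAST i. s \<le> t i)"
  have "s \<le> t n" using s tn by simp
  then have k: "s \<le> t k" "k \<le> n" unfolding k_def by (auto intro: LeastI Least_le)
  show ?thesis
  proof (cases "s = t k")
    case True
    then show ?thesis using k by auto
  next
    case False
    then have "s < t k" using k by simp
    then have "k \<noteq> 0" using s t0 by (cases "k = 0") auto
    then obtain i where i: "k = Suc i" using not0_implies_Suc by blast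
    have "\<not> s \<le> t i" using not_less_Least[of i "\<lambda>i. s \<le> t i"] i k_def by simp
    then show ?thesis using i k \<open>s < t k\<close> by (intro disjI2 exI[of _ i]) auto
  qed
qed

abbreviation block :: "nat \<Rightarrow> 'a set" where
  "block i \<equiv> stays_below g {t i<..<t (i + 1)}"

definition bridge_prob :: "nat \<Rightarrow> 'a \<Rightarrow> real" where
  "bridge_prob i \<omega> = p i (W (t i) \<omega>, W (t (i + 1)) \<omega>)"

definition grid_below :: "'a \<Rightarrow> real" where
  "grid_below \<omega> = (\<Prod>j\<in>{..n}. indicator {..g (t j)} (W (t j) \<omega>))"

lemma stays_below_factorization:
  "\<omega> \<in> space M \<Longrightarrow> indicator (stays_below g {q..d}) \<omega> = (\<Prod>i\<in>{0..<n}. indicator (block i) \<omega>) * grid_below \<omega>"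
proof -
  assume \<omega>: "\<omega> \<in> space M"
  have r: "{t i<..<t (i + 1)} \<subseteq> {q..d}" if "i < n" for i
    using t_range[of i] t_range[of "i + 1"] that by auto
  have "\<omega> \<in> stays_below g {q..d} \<longleftrightarrow> (\<forall>i<n. \<omega> \<in> block i) \<and> (\<forall>j\<le>n. W (t j) \<omega> \<le> g (t j))"
  proof
    assume "\<omega> \<in> stays_below g {q..d}"
    then show "(\<forall>i<n. \<omega> \<in> block i) \<and> (\<forall>j\<le>n. W (t j) \<omega> \<le> g (t j))"
      using r t_range by (auto simp: stays_below_def subset_eq)
  next
    assume *: "(\<forall>i<n. \<omega> \<in> block i) \<and> (\<forall>j\<le>n. W (t j) \<omega> \<le> g (t j))"
    have "W s \<omega> \<le> g s" if "s \<in> {q..d}" for s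
      using grid_covers[OF that] * by (auto simp: stays_below_def)
    then show "\<omega> \<in> stays_below g {q..d}" using \<omega> by (simp add: stays_below_def)
  qed
  then show ?thesis
    by (auto simp: grid_below_def indicator_def)
qed

text \<open>
  One block at a time is replaced by its conditional probability. All other factors, whether already
  replaced or not, depend only on values outside the open block, so \<open>markov_block\<close> applies.
\<close>
lemma block_replacement:
  assumes "k \<le> n"
  shows "(\<integral>\<omega>. (\<Prod>i\<in>{0..<n}. indicator (block i) \<omega>) * grid_below \<omega> \<partial>M) =
    (\<integral>\<omega>. (\<Prod>i\<in>{0..<k}. bridge_prob i \<omega>) * (\<Prod>i\<in>{k..<n}. indicator (block i) \<omega>) * grid_below \<omega> \<partial>M)"
  using assms
proof (induction k)
  case 0
  then show ?case by simp
next
  case (Suc k)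
  then have k: "k < n" by simp
  define Z where "Z \<omega> = (\<Prod>i\<in>{0..<k}. bridge_prob i \<omega>) * (\<Prod>i\<in>{Suc k..<n}. indicator (block i) \<omega>) * grid_below \<omega>" for \<omega>
  let ?J = "{q..d} - {t k<..<t (k + 1)}"
  let ?N = "generated_algebra M W ?J"
  have tJ: "t j \<in> ?J" if "j \<le> n" for j
    using t_range[OF that] t_mono[of j k] t_mono[of "k + 1" j] k that by (cases "j \<le> k") auto
  have WN [measurable]: "W (t j) \<in> borel_measurable ?N" if "j \<le> n" for j
    by (rule measurable_generated_algebra[OF tJ[OF that]])
  have PN [measurable]: "bridge_prob i \<in> borel_measurable ?N" if "i < n" for i
  proof -
    have [measurable]: "W (t i) \<in> borel_measurable ?N" by (rule WN) (use that in simp)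
    have [measurable]: "W (t (i + 1)) \<in> borel_measurable ?N" by (rule WN) (use that in simp)
    have "(\<lambda>\<omega>. (W (t i) \<omega>, W (t (i + 1)) \<omega>)) \<in> ?N \<rightarrow>\<^sub>M borel"
      unfolding borel_prod[symmetric] by measurable
    then show ?thesis unfolding bridge_prob_def[abs_def] by (rule measurable_compose[OF _ p_measurable[OF that]])
  qed
  have BN [measurable]: "block i \<in> sets ?N" if "i < n" "i \<noteq> k" for i
  proof (rule stays_below_sets_generated)
    show "{t i<..<t (i + 1)} \<subseteq> ?J"
      using t_range[of i] t_range[of "i + 1"] t_mono[of "i + 1" k] t_mono[of "k + 1" i] that k
      by (cases "i < k") auto
  qed auto
  have GN [measurable]: "grid_below \<in> borel_measurable ?N"
    unfolding grid_below_def[abs_def]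
    by (intro borel_measurable_prod measurable_compose[OF WN borel_measurable_indicator]) auto
  have Zm: "Z \<in> borel_measurable ?N"
    unfolding Z_def[abs_def] using k by (intro borel_measurable_times borel_measurable_prod GN PN borel_measurable_indicator BN) auto
  have P01: "0 \<le> bridge_prob i \<omega>" "bridge_prob i \<omega> \<le> 1" if "i < n" for i \<omega>
    using p_nonneg p_le_1 that by (auto simp: bridge_prob_def)
  have Z1: "\<bar>Z \<omega>\<bar> \<le> 1" for \<omega>
  proof -
    have "\<bar>\<Prod>i\<in>{0..<k}. bridge_prob i \<omega>\<bar> \<le> 1" using P01 k by (auto simp: abs_prod intro!: prod_le_1)
    moreover have "\<bar>\<Prod>i\<in>{Suc k..<n}. indicator (block i) \<omega> :: real\<bar> \<le> 1" by (auto simp: abs_prod intro!: prod_le_1)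
    moreover have "\<bar>grid_below \<omega>\<bar> \<le> 1" by (auto simp: grid_below_def abs_prod intro!: prod_le_1)
    ultimately show ?thesis unfolding Z_def abs_mult by (intro mult_le_one) auto
  qed
  have ab: "q \<le> t k" "t k < t (k + 1)" "t (k + 1) \<le> d"
    using t_range[of k] t_range[of "k + 1"] t_step[OF k] k by auto
  have subN: "subalgebra M ?N" by (rule subalgebra_generated_algebra) auto
  have zero: "(\<integral>\<omega>. (indicator (block k) \<omega> - p k (W (t k) \<omega>, W (t (k + 1)) \<omega>)) * Z \<omega> \<partial>M) = 0"
  proof (rule markov_block[OF ab _ p_measurable[OF k] _ _ p_cond[OF k] Zm Z1])
    show "block k \<in> sets (generated_algebra M W {t k..t (k + 1)})"
      using ab by (intro stays_below_sets_generated) auto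
  qed (use p_nonneg p_le_1 k in auto)
  have ZM [measurable]: "Z \<in> borel_measurable M" by (rule measurable_from_subalg[OF subN Zm])
  have PM [measurable]: "bridge_prob k \<in> borel_measurable M" by (rule measurable_from_subalg[OF subN PN[OF k]])
  have BM [measurable]: "block k \<in> sets M" using ab by (intro stays_below_sets) auto
  have i1: "integrable M (\<lambda>\<omega>. indicator (block k) \<omega> * Z \<omega>)"
  proof (rule integrable_bounded[of _ 1])
    show "norm (indicator (block k) \<omega> * Z \<omega>) \<le> 1" for \<omega>
      using Z1 by (auto simp: indicator_def)
  qed measurable
  have i2: "integrable M (\<lambda>\<omega>. bridge_prob k \<omega> * Z \<omega>)"
  proof (rule integrable_bounded[of _ 1])
    show "norm (bridge_prob k \<omega> * Z \<omega>) \<le> 1" for \<omega>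
      using mult_le_one[of "\<bar>bridge_prob k \<omega>\<bar>" "\<bar>Z \<omega>\<bar>"] P01[OF k] Z1 by (simp add: abs_mult)
  qed measurable
  have "(\<integral>\<omega>. (indicator (block k) \<omega> * Z \<omega>) - (bridge_prob k \<omega> * Z \<omega>) \<partial>M) = 0"
    using zero by (simp add: bridge_prob_def left_diff_distrib)
  then have "(\<integral>\<omega>. indicator (block k) \<omega> * Z \<omega> \<partial>M) = (\<integral>\<omega>. bridge_prob k \<omega> * Z \<omega> \<partial>M)"
    using i1 i2 by simp
  moreover have "(\<Prod>i\<in>{k..<n}. indicator (block i) \<omega> :: real) = indicator (block k) \<omega> * (\<Prod>i\<in>{Suc k..<n}. indicator (block i) \<omega>)" for \<omega>
    using k by (rule prod.atLeast_Suc_lessThan)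
  ultimately show ?case
    using Suc by (simp add: Z_def mult_ac)
qed

corollary prob_stays_below:
  "prob (stays_below g {q..d}) = (\<integral>\<omega>. grid_below \<omega> * (\<Prod>i\<in>{0..<n}. bridge_prob i \<omega>) \<partial>M)"
proof -
  have "prob (stays_below g {q..d}) = (\<integral>\<omega>. indicator (stays_below g {q..d}) \<omega> \<partial>M)"
    using stays_below_sets[of "{q..d}"] by simp
  also have "\<dots> = (\<integral>\<omega>. (\<Prod>i\<in>{0..<n}. indicator (block i) \<omega>) * grid_below \<omega> \<partial>M)"
    by (intro Bochner_Integration.integral_cong refl stays_below_factorization)
  also have "\<dots> = (\<integral>\<omega>. (\<Prod>i\<in>{0..<n}. bridge_prob i \<omega>) * (\<Prod>i\<in>{n..<n}. indicator (block i) \<omega>) * grid_below \<omega> \<partial>M)"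
    by (rule block_replacement) simp
  finally show ?thesis by (simp add: mult.commute)
qed

end

section \<open>The densities of the grid values\<close>

text \<open>
  The joint density of the two end values. The quadratic form becomes diagonal in the sum and the
  difference of the coordinates, whose variances are proportional to \<open>3 * q - d\<close> and \<open>d - q\<close>.
\<close>
lemma normal_density_pair:
  fixes q d x y :: real
  assumes q: "0 < q" and qd: "q < d" and d: "d < 3 * q"
  shows "std_normal_density x * normal_density ((1 - (d - q) / q) * x) (sqrt ((d - q) * (3 * q - d) / q\<^sup>2)) y =
    q / (2 * pi * sqrt ((3 * q - d) * (d - q))) *
    exp (- (q / 4) * ((x + y)\<^sup>2 / (3 * q - d) + (x - y)\<^sup>2 / (d - q)))"
proof -
  define w u where "w = d - q" and "u = 3 * q - d"
  have w: "w > 0" and u: "u > 0" and q2: "q = (u + w) / 2" using qd d by (auto simp: w_def u_def)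
  define D where "D = w * u / q\<^sup>2"
  have D: "D > 0" using w u q by (simp add: D_def)
  have sD: "sqrt D = sqrt (u * w) / q"
    using q by (simp add: D_def real_sqrt_divide mult.commute)
  have e: "- x\<^sup>2 / 2 + - ((y - (1 - w / q) * x)\<^sup>2) / (2 * D) = - (q / 4) * ((x + y)\<^sup>2 / u + (x - y)\<^sup>2 / w)"
  proof -
    have "y - (1 - w / q) * x = (q * y - (q - w) * x) / q" using q by (simp add: field_simps)
    then have "(y - (1 - w / q) * x)\<^sup>2 / (2 * D) = (q * y - (q - w) * x)\<^sup>2 / (2 * w * u)"
      using q by (simp add: D_def power_divide)
    moreover have "x\<^sup>2 / 2 + (q * y - (q - w) * x)\<^sup>2 / (2 * w * u) = (q / 4) * ((x + y)\<^sup>2 / u + (x - y)\<^sup>2 / w)"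
      using w u unfolding q2 by (simp add: divide_simps) (simp add: power2_eq_square algebra_simps)
    ultimately show ?thesis by (simp add: field_simps)
  qed
  have "std_normal_density x * normal_density ((1 - w / q) * x) (sqrt D) y
      = (1 / sqrt (2 * pi) * (1 / sqrt (2 * pi * D))) * exp (- x\<^sup>2 / 2 + - ((y - (1 - w / q) * x)\<^sup>2) / (2 * D))"
    using D unfolding normal_density_def exp_add by simp
  also have "1 / sqrt (2 * pi) * (1 / sqrt (2 * pi * D)) = q / (2 * pi * sqrt (u * w))"
    using q by (simp add: real_sqrt_mult[of _ D] sD)
  finally show ?thesis unfolding e by (simp add: w_def u_def D_def)
qed

text \<open>
  The exponents reflect Bayes' rule for increments of variance \<open>2 / q\<close> per unit of time: the
  density of passing through \<open>z\<close> divided by the density of going directly from \<open>x\<close> to \<open>y\<close>.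
\<close>
lemma normal_density_bridge:
  fixes q s b x y z :: real
  assumes q: "0 < q" and s: "q < s" and b: "s < b"
  shows "normal_density (((b - s) / (b - q)) * x + ((s - q) / (b - q)) * y)
      (sqrt (2 * (s - q) * (b - s) / (q * (b - q)))) z =
    sqrt (q / (4 * pi)) * (sqrt (b - q) / sqrt ((b - s) * (s - q))) *
    exp (- (q / 4) * ((z - x)\<^sup>2 / (s - q) + (y - z)\<^sup>2 / (b - s) - (y - x)\<^sup>2 / (b - q)))"
proof -
  define A B where "A = s - q" and "B = b - s"
  have A: "A > 0" and B: "B > 0" and AB: "b - q = A + B" using s b by (auto simp: A_def B_def)
  define v where "v = 2 * A * B / (q * (A + B))"
  have v: "v > 0" using A B q by (simp add: v_def)
  have n: "1 / sqrt (2 * pi * v) = sqrt (q / (4 * pi)) * (sqrt (A + B) / sqrt (B * A))"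
  proof -
    have "1 / (2 * pi * v) = (q / (4 * pi)) * ((A + B) / (B * A))"
      using A B q by (simp add: v_def field_simps)
    then have "sqrt (1 / (2 * pi * v)) = sqrt ((q / (4 * pi)) * ((A + B) / (B * A)))" by simp
    then show ?thesis by (simp add: real_sqrt_mult real_sqrt_divide)
  qed
  have "(z - (B / (A + B) * x + A / (A + B) * y))\<^sup>2 / (2 * v)
      = (q / 4) * (((A + B) * z - B * x - A * y)\<^sup>2 / (A * B * (A + B)))"
  proof -
    have "z - (B / (A + B) * x + A / (A + B) * y) = ((A + B) * z - B * x - A * y) / (A + B)"
      using A B by (simp add: diff_divide_distrib)
    then show ?thesis using A B q by (simp add: v_def power_divide power2_eq_square) (simp only: mult_ac)
  qed
  also have "((A + B) * z - B * x - A * y)\<^sup>2 / (A * B * (A + B)) = (z - x)\<^sup>2 / A + (y - z)\<^sup>2 / B - (y - x)\<^sup>2 / (A + B)"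
  proof -
    have "A + B \<noteq> 0" using A B by simp
    then show ?thesis
      using A B by (simp add: divide_simps) (simp add: power2_eq_square algebra_simps)
  qed
  finally have e: "- ((z - (B / (A + B) * x + A / (A + B) * y))\<^sup>2) / (2 * v)
      = - (q / 4) * ((z - x)\<^sup>2 / A + (y - z)\<^sup>2 / B - (y - x)\<^sup>2 / (A + B))"
    by simp
  have "normal_density (B / (A + B) * x + A / (A + B) * y) (sqrt v) z
      = 1 / sqrt (2 * pi * v) * exp (- ((z - (B / (A + B) * x + A / (A + B) * y))\<^sup>2) / (2 * v))"
    using v by (simp add: normal_density_def)
  also have "\<dots> = sqrt (q / (4 * pi)) * (sqrt (A + B) / sqrt (B * A)) *
      exp (- (q / 4) * ((z - x)\<^sup>2 / A + (y - z)\<^sup>2 / B - (y - x)\<^sup>2 / (A + B)))"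
    unfolding n e by simp
  finally show ?thesis unfolding AB v_def by (simp add: A_def B_def)
qed

lemma powr_half_Suc:
  fixes x :: real
  assumes "x > 0"
  shows "x powr ((real (Suc k) + 1) / 2) = x * sqrt x ^ k"
proof -
  have "(real (Suc k) + 1) / 2 = 1 + (1/2) * real k" by (simp add: field_simps)
  then have "x powr ((real (Suc k) + 1) / 2) = x powr 1 * (x powr (1/2)) powr real k"
    by (simp only: powr_add powr_powr)
  then show ?thesis using assms by (simp add: powr_half_sqrt powr_realpow)
qed

lemma normalizing_constant:
  fixes q S :: real
  assumes q: "q > 0" and n: "n \<ge> 1"
  shows "q powr ((real n + 1) / 2) / (2 ^ n * pi powr ((real n + 1) / 2) * S) =
    q / (2 * pi * S) * sqrt (q / (4 * pi)) ^ (n - 1)"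
proof -
  obtain k where k: "n = Suc k" using n by (cases n) auto
  have "sqrt (q / (4 * pi)) = sqrt q / (2 * sqrt pi)" by (simp add: real_sqrt_divide real_sqrt_mult)
  then show ?thesis
    unfolding k powr_half_Suc[OF q] powr_half_Suc[OF pi_gt_zero]
    by (simp add: power_divide power_mult_distrib)
qed

lemma descending_split:
  assumes "rev [1..<n + 1] = as @ k # bs"
  shows "1 \<le> k" "k \<le> n" "set as = {k + 1..n}"
proof -
  have r: "[1..<n + 1] = rev bs @ k # rev as" using arg_cong[OF assms, of rev] by simp
  let ?l = "length bs"
  have len: "?l < n" using arg_cong[OF r, of length] by (simp del: upt_Suc)
  have "[1..<n + 1] ! ?l = k" unfolding r by (simp add: nth_append)
  then have k: "k = 1 + ?l" using len by (subst (asm) nth_upt) auto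
  then show "1 \<le> k" "k \<le> n" using len by auto
  have "drop (Suc ?l) [1..<n + 1] = rev as" unfolding r by simp
  then have "[1 + Suc ?l..<n + 1] = rev as" by (simp only: drop_upt)
  from arg_cong[OF this, of set] show "set as = {k + 1..n}" using k by auto
qed

context slepian_grid
begin

definition W_grid :: "nat \<Rightarrow> 'a \<Rightarrow> real" where "W_grid i = W (t i)"

definition integration_order :: "nat list" where "integration_order = 0 # rev [1..<n + 1]"

text \<open>
  \<open>cond_mean k\<close> and \<open>cond_var k\<close> are the mean and variance of \<open>W (t k)\<close> given the values at the grid
  points that precede \<open>k\<close> in \<open>integration_order\<close>. The point \<open>t n\<close> has only \<open>t 0\<close> before it; every
  other point after \<open>t 0\<close> lies between \<open>t 0\<close> and its neighbour \<open>t (k + 1)\<close>, both already present.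
\<close>
definition cond_mean :: "nat \<Rightarrow> (nat \<Rightarrow> real) \<Rightarrow> real" where
  "cond_mean k x = (if k = 0 then 0 else if k = n then (1 - (d - q) / q) * x 0
     else lin_interp q (t (k + 1)) (t k) (x 0) (x (k + 1)))"

definition cond_var :: "nat \<Rightarrow> real" where
  "cond_var k = (if k = 0 then 1 else if k = n then (d - q) * (3 * q - d) / q\<^sup>2
     else 2 * (t k - q) * (t (k + 1) - t k) / (q * (t (k + 1) - q)))"

lemma integration_order_split:
  assumes "integration_order = as @ k # bs"
  obtains "k = 0" "as = []" | "1 \<le> k" "k \<le> n" "set as = insert 0 {k + 1..n}"
proof (cases as)
  case Nil
  then show ?thesis using assms that(1) by (simp add: integration_order_def)
next
  case (Cons a as')
  then have "a = 0" "rev [1..<n + 1] = as' @ k # bs" using assms by (auto simp: integration_order_def)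
  then show ?thesis using descending_split[of n as' k bs] Cons by (intro that(2)) auto
qed

lemma three_q_gt_d: "d < 3 * q"
  using q_pos d_le by simp

lemma cond_var_pos: "k \<le> n \<Longrightarrow> cond_var k > 0"
  using t_less[of 0 k] t_less[of k "k + 1"] q_pos q_less_d three_q_gt_d t0
  by (auto simp: cond_var_def intro!: divide_pos_pos mult_pos_pos)

text \<open>
  All points preceding \<open>k\<close> lie outside the open interval from \<open>q\<close> to \<open>t (k + 1)\<close>, which is what
  \<open>bridge_orthogonal\<close> requires.
\<close>
lemma residual:
  assumes split: "integration_order = as @ k # bs"
  defines "R \<equiv> \<lambda>\<omega>. W_grid k \<omega> - cond_mean k (masked W_grid (set as) \<omega>)"
  shows "R \<in> lin_comb W {q..d}" "inner_E R R = cond_var k" "\<And>j. j \<in> set as \<Longrightarrow> inner_E R (W (t j)) = 0"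
proof -
  have ends: "q \<in> {q..d}" "d \<in> {q..d}" using q_less_d by auto
  have "R \<in> lin_comb W {q..d} \<and> inner_E R R = cond_var k \<and> (\<forall>j\<in>set as. inner_E R (W (t j)) = 0)"
    using split
  proof (cases rule: integration_order_split)
    case 1
    have R: "R = W q" unfolding R_def W_grid_def cond_mean_def 1 t0 by simp
    show ?thesis unfolding R using lin_W[OF ends(1)] inner_W[OF ends(1,1)] 1 by (simp add: cond_var_def)
  next
    case 2
    have m0: "masked W_grid (set as) \<omega> 0 = W q \<omega>" for \<omega> unfolding 2 masked_def W_grid_def t0 by simp
    show ?thesis
    proof (cases "k = n")
      case True
      let ?\<rho> = "1 - (d - q) / q"
      have R: "R = (\<lambda>\<omega>. W d \<omega> - (?\<rho> * W q \<omega> + 0 * W q \<omega>))"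
        unfolding R_def W_grid_def cond_mean_def m0 True tn using n by simp
      have RL: "R \<in> lin_comb W {q..d}" unfolding R by (rule lin_comb_minus2[OF ends(2,1,1)])
      have Rq: "inner_E R (W q) = 0"
        unfolding R using inner_minus2[OF ends(2,1,1,1), of ?\<rho> 0] q_less_d by simp
      have Rd: "inner_E R (W d) = 1 - ?\<rho> * ?\<rho>"
        unfolding R using inner_minus2[OF ends(2,1,1,2), of ?\<rho> 0] q_less_d by simp
      have "inner_E R R = inner_E (\<lambda>\<omega>. W d \<omega> - ?\<rho> * W q \<omega>) R" unfolding R by simp
      also have "\<dots> = inner_E (W d) R - ?\<rho> * inner_E (W q) R"
        unfolding inner_diff_left[OF lin_W[OF ends(2)] lin_comb_scale[OF lin_W[OF ends(1)]] RL] inner_scale_left ..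
      also have "\<dots> = 1 - ?\<rho> * ?\<rho>"
        using Rq Rd inner_commute[of R "W q"] inner_commute[of R "W d"] by simp
      also have "\<dots> = cond_var k"
        using n q_pos unfolding True cond_var_def by (simp add: field_simps power2_eq_square)
      finally show ?thesis using RL Rq 2 True t0 by auto
    next
      case False
      then have kn: "k < n" using 2 by simp
      have m1: "masked W_grid (set as) \<omega> (k + 1) = W (t (k + 1)) \<omega>" for \<omega>
        using kn unfolding 2 masked_def W_grid_def by simp
      have R: "R = (\<lambda>\<omega>. W (t k) \<omega> - lin_interp q (t (k + 1)) (t k) (W q \<omega>) (W (t (k + 1)) \<omega>))"
        using 2 False unfolding R_def W_grid_def cond_mean_def m0 m1 by simp
      have le: "q \<le> q" "q < t (k + 1)" "t (k + 1) \<le> d" "q \<le> t k" "t k \<le> t (k + 1)"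
        using t_less[of 0 "k + 1"] t_range[of "k + 1"] t_range[of k] t_less[of k "k + 1"] kn t0 by auto
      have "R \<in> lin_comb W {q..d}"
        unfolding R lin_interp_def by (rule lin_comb_minus2) (use le in auto)
      moreover have "inner_E R R = cond_var k"
        unfolding R bridge_variance[OF le] using 2 False by (simp add: cond_var_def)
      moreover have "inner_E R (W (t j)) = 0" if "j \<in> set as" for j
        unfolding R
      proof (rule bridge_orthogonal[OF le])
        show "t j \<in> {q..d}" using that 2 by (auto intro!: t_range[simplified])
        show "t j \<le> q \<or> t (k + 1) \<le> t j" using that 2 t0 t_mono[of "k + 1" j] by auto
      qed
      ultimately show ?thesis by blast
    qed
  qed
  then show "R \<in> lin_comb W {q..d}" "inner_E R R = cond_var k" "\<And>j. j \<in> set as \<Longrightarrow> inner_E R (W (t j)) = 0"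
    by auto
qed

lemma set_integration_order: "set integration_order = {..n}"
  by (auto simp: integration_order_def)

lemma grid_expectation:
  assumes H: "H \<in> borel_measurable seq_space" and H1: "\<And>x. \<bar>H x\<bar> \<le> B"
  shows "(\<integral>\<omega>. grid_below \<omega> * H (masked W_grid {..n} \<omega>) \<partial>M) =
    iterated_integral (\<lambda>i. g (t i)) integration_order
      (\<lambda>x. (\<Prod>j\<in>{..n}. normal_density (cond_mean j x) (sqrt (cond_var j)) (x j)) * H x) (\<lambda>_. 0)"
proof -
  have "(\<integral>\<omega>. (\<Prod>j\<in>set integration_order. indicator {..g (t j)} (W_grid j \<omega>)) * H (masked W_grid (set integration_order) \<omega>) \<partial>M) =
    iterated_integral (\<lambda>i. g (t i)) integration_order
      (\<lambda>x. (\<Prod>j\<in>set integration_order. normal_density (cond_mean j x) (sqrt (cond_var j)) (x j)) * H x) (\<lambda>_. 0)"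
  proof (rule sequential_density[OF _ _ _ _ _ _ _ H H1])
    show "distinct integration_order" by (simp add: integration_order_def)
    show "W_grid j \<in> borel_measurable M" if "j \<in> set integration_order" for j
      using that by (auto simp: W_grid_def set_integration_order)
    fix as k bs assume split: "integration_order = as @ k # bs"
    have kn: "k \<le> n" and as: "set as \<subseteq> {..n}" using set_integration_order split by auto
    let ?R = "\<lambda>\<omega>. W_grid k \<omega> - cond_mean k (masked W_grid (set as) \<omega>)"
    note R = residual[OF split]
    show "sqrt (cond_var k) > 0" using cond_var_pos[OF kn] by simp
    show "cond_mean k \<in> borel_measurable seq_space"
      unfolding cond_mean_def[abs_def] lin_interp_def by measurable
    show "distributed M lborel ?R (normal_density 0 (sqrt (cond_var k)))"
      by (rule distributed_lin[OF R(1,2) cond_var_pos[OF kn]])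
    show "distr M borel ?R \<Otimes>\<^sub>M distr M seq_space (masked W_grid (set as)) =
        distr M (borel \<Otimes>\<^sub>M seq_space) (\<lambda>\<omega>. (?R \<omega>, masked W_grid (set as) \<omega>))"
    proof (rule orthogonal_product_law[OF R(1)])
      show "t ` set as \<subseteq> {q..d}" using as t_range by auto
      show "inner_E ?R (W r) = 0" if "r \<in> t ` set as" for r using that R(3) by blast
      show "masked W_grid (set as) \<in> generated_algebra M W (t ` set as) \<rightarrow>\<^sub>M seq_space"
        by (intro masked_measurable) (auto simp: W_grid_def intro!: measurable_generated_algebra)
    qed
    show "cond_mean k (x(j := y)) = cond_mean k x" if "j \<notin> set as" for j x y
      using split
    proof (cases rule: integration_order_split)
      case 2
      then have "j \<noteq> 0" "k \<noteq> n \<Longrightarrow> j \<noteq> k + 1" using that by auto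
      then show ?thesis by (auto simp: cond_mean_def)
    qed (auto simp: cond_mean_def)
  qed
  then show ?thesis unfolding set_integration_order by (simp add: grid_below_def W_grid_def)
qed

text \<open>
  Each interior point contributes a factor \<open>sqrt (q / (4 * pi))\<close>; with the constant of the end
  points these make up the normalizing constant.
\<close>
lemma density_product:
  "(\<Prod>j\<in>{..n}. normal_density (cond_mean j x) (sqrt (cond_var j)) (x j)) =
    q powr ((real n + 1) / 2) / (2 ^ n * pi powr ((real n + 1) / 2) * sqrt ((3 * q - d) * (d - q))) *
    (\<Prod>i\<in>{1..<n}. sqrt (t (i + 1) - q) / sqrt ((t (i + 1) - t i) * (t i - q))) *
    (exp (- (q / 4) * ((x 0 + x n)\<^sup>2 / (3 * q - d) + (x 0 - x n)\<^sup>2 / (d - q))) *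
     (\<Prod>i\<in>{1..<n}. exp (- (q / 4) * ((x i - x 0)\<^sup>2 / (t i - q) + (x (i + 1) - x i)\<^sup>2 / (t (i + 1) - t i)
        - (x (i + 1) - x 0)\<^sup>2 / (t (i + 1) - q)))))"
proof -
  let ?f = "\<lambda>j. normal_density (cond_mean j x) (sqrt (cond_var j)) (x j)"
  have "{..n} = insert 0 (insert n {1..<n})" using n by auto
  then have "(\<Prod>j\<in>{..n}. ?f j) = ?f 0 * (?f n * (\<Prod>j\<in>{1..<n}. ?f j))"
    using n by simp
  also have "\<dots> = (?f 0 * ?f n) * (\<Prod>j\<in>{1..<n}. ?f j)" by simp
  also have "?f 0 * ?f n = q / (2 * pi * sqrt ((3 * q - d) * (d - q))) *
      exp (- (q / 4) * ((x 0 + x n)\<^sup>2 / (3 * q - d) + (x 0 - x n)\<^sup>2 / (d - q)))"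
    unfolding normal_density_pair[OF q_pos q_less_d three_q_gt_d, symmetric]
    using n by (simp add: cond_mean_def cond_var_def)
  also have "(\<Prod>j\<in>{1..<n}. ?f j) = (\<Prod>i\<in>{1..<n}. sqrt (q / (4 * pi)) *
      ((sqrt (t (i + 1) - q) / sqrt ((t (i + 1) - t i) * (t i - q))) *
      exp (- (q / 4) * ((x i - x 0)\<^sup>2 / (t i - q) + (x (i + 1) - x i)\<^sup>2 / (t (i + 1) - t i)
        - (x (i + 1) - x 0)\<^sup>2 / (t (i + 1) - q)))))"
  proof (rule prod.cong[OF refl])
    fix i assume i: "i \<in> {1..<n}"
    then have "q < t i" "t i < t (i + 1)" using t_less[of 0 i] t_less[of i "i + 1"] t0 by auto
    from normal_density_bridge[OF q_pos this, of "x 0" "x (i + 1)" "x i"]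
    show "?f i = sqrt (q / (4 * pi)) *
      ((sqrt (t (i + 1) - q) / sqrt ((t (i + 1) - t i) * (t i - q))) *
      exp (- (q / 4) * ((x i - x 0)\<^sup>2 / (t i - q) + (x (i + 1) - x i)\<^sup>2 / (t (i + 1) - t i)
        - (x (i + 1) - x 0)\<^sup>2 / (t (i + 1) - q))))"
      using i by (simp add: cond_mean_def cond_var_def lin_interp_def)
  qed
  finally show ?thesis
    unfolding normalizing_constant[OF q_pos n] by (simp only: prod.distrib prod_constant card_atLeastLessThan mult_ac)
qed

theorem prob_stays_below_formula:
  "prob (stays_below g {q..d}) =
    q powr ((real n + 1) / 2) / (2 ^ n * pi powr ((real n + 1) / 2) * sqrt ((3 * q - d) * (d - q))) *
    (\<Prod>i\<in>{1..<n}. sqrt (t (i + 1) - q) / sqrt ((t (i + 1) - t i) * (t i - q))) *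
    iterated_integral (\<lambda>i. g (t i)) (0 # rev [1..<n + 1])
      (\<lambda>x. exp (- (q / 4) * ((x 0 + x n)\<^sup>2 / (3 * q - d) + (x 0 - x n)\<^sup>2 / (d - q))) *
        p 0 (x 0, x 1) *
        (\<Prod>i\<in>{1..<n}. p i (x i, x (i + 1)) *
          exp (- (q / 4) * ((x i - x 0)\<^sup>2 / (t i - q)
                             + (x (i + 1) - x i)\<^sup>2 / (t (i + 1) - t i)
                             - (x (i + 1) - x 0)\<^sup>2 / (t (i + 1) - q)))))
      (\<lambda>_. 0)" (is "_ = ?c * ?\<Pi> * _")
proof -
  define H where "H x = (\<Prod>i\<in>{0..<n}. p i (x i, x (i + 1)))" for x :: "nat \<Rightarrow> real"
  have H: "H \<in> borel_measurable seq_space"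
    unfolding H_def[abs_def]
  proof (intro borel_measurable_prod)
    fix i assume i: "i \<in> {0..<n}"
    have "(\<lambda>x. (x i, x (i + 1))) \<in> seq_space \<rightarrow>\<^sub>M borel"
      unfolding borel_prod[symmetric] by measurable
    then show "(\<lambda>x. p i (x i, x (i + 1))) \<in> borel_measurable seq_space"
      by (rule measurable_compose) (use i p_measurable in simp)
  qed
  have H1: "\<bar>H x\<bar> \<le> 1" for x
    unfolding H_def using p_nonneg p_le_1 by (auto simp: abs_prod intro!: prod_le_1)
  have Hm: "H (masked W_grid {..n} \<omega>) = (\<Prod>i\<in>{0..<n}. bridge_prob i \<omega>)" for \<omega>
    unfolding H_def by (intro prod.cong) (auto simp: masked_def W_grid_def bridge_prob_def)
  have H0: "H x = p 0 (x 0, x 1) * (\<Prod>i\<in>{1..<n}. p i (x i, x (i + 1)))" for x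
    unfolding H_def using prod.atLeast_Suc_lessThan[of 0 n "\<lambda>i. p i (x i, x (i + 1))"] n by simp
  have "prob (stays_below g {q..d}) = (\<integral>\<omega>. grid_below \<omega> * H (masked W_grid {..n} \<omega>) \<partial>M)"
    unfolding Hm by (rule prob_stays_below)
  also have "\<dots> = iterated_integral (\<lambda>i. g (t i)) integration_order
      (\<lambda>x. (\<Prod>j\<in>{..n}. normal_density (cond_mean j x) (sqrt (cond_var j)) (x j)) * H x) (\<lambda>_. 0)"
    by (rule grid_expectation[OF H H1])
  also have "(\<lambda>x. (\<Prod>j\<in>{..n}. normal_density (cond_mean j x) (sqrt (cond_var j)) (x j)) * H x) =
    (\<lambda>x. (?c * ?\<Pi>) * (exp (- (q / 4) * ((x 0 + x n)\<^sup>2 / (3 * q - d) + (x 0 - x n)\<^sup>2 / (d - q))) *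
        p 0 (x 0, x 1) *
        (\<Prod>i\<in>{1..<n}. p i (x i, x (i + 1)) *
          exp (- (q / 4) * ((x i - x 0)\<^sup>2 / (t i - q)
                             + (x (i + 1) - x i)\<^sup>2 / (t (i + 1) - t i)
                             - (x (i + 1) - x 0)\<^sup>2 / (t (i + 1) - q))))))"
    unfolding density_product H0 prod.distrib by (simp only: mult_ac)
  finally show ?thesis unfolding iterated_integral_mult integration_order_def .
qed

end


section \<open>The boundary crossing probability\<close>

theorem theorem2p1:
  fixes q d :: real and M :: "'a measure" and W :: "real \<Rightarrow> 'a \<Rightarrow> real"
    and n :: nat and t :: "nat \<Rightarrow> real" and g :: "real \<Rightarrow> real" and c :: real
    and K :: "nat \<Rightarrow> real \<times> real \<Rightarrow> (real \<Rightarrow> real) measure"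
    and P :: "nat \<Rightarrow> real \<Rightarrow> real \<Rightarrow> real"
  assumes "0 < q" and "q < d" and "d \<le> 2 * q"
    and "slepian_process q d M W"
    and "n \<ge> 1"
    and "t 0 = q" and "t n = d" and "\<And>i. i < n \<Longrightarrow> t i < t (i + 1)"
    and "g \<in> borel_measurable (restrict_space borel {q..d})"
    and "\<And>i. i < n \<Longrightarrow> gaussian_conditional_law q d M W (t i) (t (i + 1)) (K i)"
  defines "c \<equiv> q powr ((real n + 1) / 2) /
      (2 ^ n * pi powr ((real n + 1) / 2) * sqrt ((3 * q - d) * (d - q)))"
    and "P \<equiv> \<lambda>i x y. measure (K i (x, y))
      {f \<in> space (path_space q d). \<forall>s\<in>{t i<..<t (i + 1)}. f s \<le> g s}"
  shows "measure M {\<omega> \<in> space M. \<exists>s\<in>{q..d}. W s \<omega> > g s} =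
    1 - c * (\<Prod>i\<in>{1..<n}. sqrt (t (i + 1) - q) / sqrt ((t (i + 1) - t i) * (t i - q))) *
      iterated_integral (\<lambda>i. g (t i)) (0 # rev [1..<n + 1])
        (\<lambda>x. exp (- (q / 4) * ((x 0 + x n)\<^sup>2 / (3 * q - d) + (x 0 - x n)\<^sup>2 / (d - q))) *
          P 0 (x 0) (x 1) *
          (\<Prod>i\<in>{1..<n}. P i (x i) (x (i + 1)) *
            exp (- (q / 4) * ((x i - x 0)\<^sup>2 / (t i - q)
                               + (x (i + 1) - x i)\<^sup>2 / (t (i + 1) - t i)
                               - (x (i + 1) - x 0)\<^sup>2 / (t (i + 1) - q)))))
        (\<lambda>_. 0)"
proof -
  interpret slepian q d M W by unfold_locales fact+
  define S where "S i = {f \<in> space (path_space q d). \<forall>s\<in>{t i<..<t (i + 1)}. f s \<le> g s}" for i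
  define p where "p i z = measure (K i z) (S i)" for i z
  have t_le: "i \<le> j \<Longrightarrow> j \<le> n \<Longrightarrow> t i \<le> t j" for i j
  proof (induction j rule: nat_induct_at_least[of i, case_names base Suc])
    case (Suc j)
    then show ?case using assms(8)[of j] by simp
  qed simp_all
  have ran: "t i \<in> {q..d}" if "i \<le> n" for i
    using t_le[of 0 i] t_le[of i n] that assms(6,7) by auto
  have inc: "{t i<..<t (i + 1)} \<subseteq> {q..d}" if "i < n" for i
    using ran[of i] ran[of "i + 1"] that by auto
  have Ss: "S i \<in> sets (path_space q d)" if "i < n" for i
    unfolding S_def by (rule path_constraint_sets[OF inc[OF that]])
  have K: "K i \<in> borel \<rightarrow>\<^sub>M prob_algebra (path_space q d)" if "i < n" for i
    using assms(10)[OF that] by (simp add: gaussian_conditional_law_def)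
  interpret slepian_grid q d M W n t g p
  proof unfold_locales
    show "p i \<in> borel_measurable borel" if "i < n" for i
      unfolding p_def[abs_def]
      by (rule measurable_compose[OF measurable_prob_algebraD[OF K[OF that]]
            measurable_measure_subprob_algebra[OF Ss[OF that]]])
    show "0 \<le> p i z" "p i z \<le> 1" if "i < n" for i z
    proof -
      have "prob_space (K i z)" using measurable_space[OF K[OF that], of z] by (simp add: space_prob_algebra)
      then show "0 \<le> p i z" "p i z \<le> 1" by (auto simp: p_def prob_space.prob_le_1)
    qed
    show "(\<integral>\<omega>. (indicator (stays_below g {t i<..<t (i + 1)}) \<omega> - p i (W (t i) \<omega>, W (t (i + 1)) \<omega>))
        * h (W (t i) \<omega>, W (t (i + 1)) \<omega>) \<partial>M) = 0"
      if "i < n" "h \<in> borel_measurable borel" "\<And>z. \<bar>h z\<bar> \<le> 1" for i and h :: "real \<times> real \<Rightarrow> real"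
      unfolding p_def
      by (rule conditional_law_integral[OF assms(10) _ _ inc S_def]) (use that ran[of i] ran[of "i + 1"] in auto)
  qed fact+
  have "{\<omega> \<in> space M. \<exists>s\<in>{q..d}. W s \<omega> > g s} = space M - stays_below g {q..d}"
    by (auto simp: stays_below_def not_le)
  then have "measure M {\<omega> \<in> space M. \<exists>s\<in>{q..d}. W s \<omega> > g s} = 1 - prob (stays_below g {q..d})"
    using prob_compl[OF stays_below_sets[of "{q..d}" g]] by simp
  then show ?thesis
    unfolding prob_stays_below_formula c_def P_def p_def S_def .
qed

end
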